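(* Let $p\in(0,\infty)$ with $p\neq2$, let $\mathfrak M$ be a finite factor equipped with its tracial state $\tau$, and let $P,Q\in\mathscr P_{1/2}(\mathfrak M)$. Then $$\|P-Q\|_p=\|(I-P)-Q\|_p=\frac1{\sqrt2}$$ if and only if there exists a partial isometry $U\in\mathfrak M$ such that $U^*U=P$, $UU^*=I-P$ and $Q=(I+U+U^* )/2$.
   Context: A finite factor is a von Neumann algebra factor admitting a (unique, faithful, normal) tracial state, i.e. $M_n(\mathbb C)$ or a $\mathrm{II}_1$ factor. $\mathscr P_{1/2}(\mathfrak M)$ is the set of projections in $\mathfrak M$ with trace $\tau(P)=1/2$, and $\|A\|_p:=\tau(|A|^p)^{1/p}$. *)

theory Defs
  imports "HOL-Analysis.Analysis" "HOL-Computational_Algebra.Polynomial"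
begin

text \<open>Complex Hilbert spaces.  The form is linear in its first argument.  The norm and the topology
  are those of the underlying real Hilbert space, whose inner product is the real part of the form.\<close>

class chilbert_space = real_inner + complete_space +
  fixes scaleC :: "complex \<Rightarrow> 'a \<Rightarrow> 'a" (infixr "*\<^sub>C" 75)
    and cinner :: "'a \<Rightarrow> 'a \<Rightarrow> complex"
  assumes scaleC_add_right: "c *\<^sub>C (x + y) = c *\<^sub>C x + c *\<^sub>C y"
    and scaleC_add_left: "(c + d) *\<^sub>C x = c *\<^sub>C x + d *\<^sub>C x"
    and scaleC_scaleC: "c *\<^sub>C (d *\<^sub>C x) = (c * d) *\<^sub>C x"
    and scaleC_of_real: "complex_of_real r *\<^sub>C x = r *\<^sub>R x"
    and cinner_commute: "cinner x y = cnj (cinner y x)"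
    and cinner_add_left: "cinner (x + y) z = cinner x z + cinner y z"
    and cinner_scaleC_left: "cinner (c *\<^sub>C x) y = c * cinner x y"
    and Re_cinner: "Re (cinner x y) = x \<bullet> y"
begin

subclass banach ..

end

lemma norm_scaleC: "norm (c *\<^sub>C x) = cmod c * norm (x :: 'h::chilbert_space)"
proof -
  have "cinner (c *\<^sub>C x) (c *\<^sub>C x) = c * cnj c * cinner x x"
    by (metis cinner_commute cinner_scaleC_left complex_cnj_mult mult.assoc)
  also have "\<dots> = complex_of_real ((cmod c)\<^sup>2) * cinner x x"
    by (simp only: complex_norm_square)
  finally have "(c *\<^sub>C x) \<bullet> (c *\<^sub>C x) = (cmod c)\<^sup>2 * (x \<bullet> x)"
    by (simp flip: Re_cinner)
  then have "(norm (c *\<^sub>C x))\<^sup>2 = (cmod c * norm x)\<^sup>2"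
    by (simp add: power2_norm_eq_inner power_mult_distrib)
  then show ?thesis
    by (simp add: power2_eq_iff_nonneg)
qed

text \<open>The type of bounded operators in HOL-Analysis consists of the real-linear ones; \<open>bounded_ops\<close>
  is \<open>B(H)\<close>.  The real and the complex operator norm coincide.\<close>

definition bounded_ops :: "('h::chilbert_space \<Rightarrow>\<^sub>L 'h) set" where
  "bounded_ops = {T :: 'h \<Rightarrow>\<^sub>L 'h. \<forall>c x. T (c *\<^sub>C x) = c *\<^sub>C T x}"

lift_definition scalar_op :: "complex \<Rightarrow> ('h::chilbert_space \<Rightarrow>\<^sub>L 'h)" is "\<lambda>c x. c *\<^sub>C x"
proof
  fix c :: complex and x y :: 'h and r :: real
  show "c *\<^sub>C (x + y) = c *\<^sub>C x + c *\<^sub>C y"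
    by (rule scaleC_add_right)
  show "c *\<^sub>C (r *\<^sub>R x) = r *\<^sub>R (c *\<^sub>C x)"
    by (metis scaleC_of_real scaleC_scaleC mult.commute)
  show "\<exists>K. \<forall>x::'h. norm (c *\<^sub>C x) \<le> norm x * K"
    by (rule exI[of _ "cmod c"]) (simp add: norm_scaleC mult.commute)
qed

definition adj :: "('h::chilbert_space \<Rightarrow>\<^sub>L 'h) \<Rightarrow> ('h \<Rightarrow>\<^sub>L 'h)" where
  "adj T = (THE S :: 'h \<Rightarrow>\<^sub>L 'h. \<forall>x y. cinner (T x) y = cinner x (S y))"

definition loewner_le :: "('h::chilbert_space \<Rightarrow>\<^sub>L 'h) \<Rightarrow> ('h \<Rightarrow>\<^sub>L 'h) \<Rightarrow> bool" where
  "loewner_le S T \<longleftrightarrow> (\<forall>x. cinner ((T - S) x) x \<in> \<real>\<^sub>\<ge>\<^sub>0)"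

definition is_projection :: "('h::chilbert_space \<Rightarrow>\<^sub>L 'h) \<Rightarrow> bool" where
  "is_projection P \<longleftrightarrow> P \<in> bounded_ops \<and> adj P = P \<and> P o\<^sub>L P = P"

definition partial_isometry :: "('h::chilbert_space \<Rightarrow>\<^sub>L 'h) \<Rightarrow> bool" where
  "partial_isometry U \<longleftrightarrow> U \<in> bounded_ops \<and>
     (\<forall>x. (\<forall>y. U y = 0 \<longrightarrow> cinner x y = 0) \<longrightarrow> norm (U x) = norm x)"

definition commutant :: "('h::chilbert_space \<Rightarrow>\<^sub>L 'h) set \<Rightarrow> ('h \<Rightarrow>\<^sub>L 'h) set" where
  "commutant M = {T \<in> bounded_ops. \<forall>S\<in>M. T o\<^sub>L S = S o\<^sub>L T}"

text \<open>A self-adjoint set of operators that equals its bicommutant is automatically a unital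
  *-subalgebra of \<open>B(H)\<close>.\<close>

definition von_neumann_algebra :: "('h::chilbert_space \<Rightarrow>\<^sub>L 'h) set \<Rightarrow> bool" where
  "von_neumann_algebra M \<longleftrightarrow>
     M \<subseteq> bounded_ops \<and> (\<forall>T\<in>M. adj T \<in> M) \<and> commutant (commutant M) = M"

definition factor :: "('h::chilbert_space \<Rightarrow>\<^sub>L 'h) set \<Rightarrow> bool" where
  "factor M \<longleftrightarrow> von_neumann_algebra M \<and> M \<inter> commutant M = range scalar_op"

definition tracial_state :: "('h::chilbert_space \<Rightarrow>\<^sub>L 'h) set \<Rightarrow> (('h \<Rightarrow>\<^sub>L 'h) \<Rightarrow> complex) \<Rightarrow> bool" where
  "tracial_state M \<tau> \<longleftrightarrow>
     (\<forall>S\<in>M. \<forall>T\<in>M. \<tau> (S + T) = \<tau> S + \<tau> T) \<and>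
     (\<forall>c. \<forall>T\<in>M. \<tau> (scalar_op c o\<^sub>L T) = c * \<tau> T) \<and>
     (\<forall>T\<in>M. \<tau> (adj T o\<^sub>L T) \<in> \<real>\<^sub>\<ge>\<^sub>0) \<and>
     \<tau> id_blinfun = 1 \<and>
     (\<forall>S\<in>M. \<forall>T\<in>M. \<tau> (S o\<^sub>L T) = \<tau> (T o\<^sub>L S))"

definition faithful_on :: "('h::chilbert_space \<Rightarrow>\<^sub>L 'h) set \<Rightarrow> (('h \<Rightarrow>\<^sub>L 'h) \<Rightarrow> complex) \<Rightarrow> bool" where
  "faithful_on M \<tau> \<longleftrightarrow> (\<forall>T\<in>M. \<tau> (adj T o\<^sub>L T) = 0 \<longrightarrow> T = 0)"

text \<open>Normality: \<open>\<tau>\<close> preserves suprema of upward directed sets of self-adjoint elements.\<close>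

definition normal_on :: "('h::chilbert_space \<Rightarrow>\<^sub>L 'h) set \<Rightarrow> (('h \<Rightarrow>\<^sub>L 'h) \<Rightarrow> complex) \<Rightarrow> bool" where
  "normal_on M \<tau> \<longleftrightarrow>
     (\<forall>D S. D \<noteq> {} \<and> D \<subseteq> {T \<in> M. adj T = T} \<and>
        (\<forall>A\<in>D. \<forall>B\<in>D. \<exists>C\<in>D. loewner_le A C \<and> loewner_le B C) \<and>
        S \<in> M \<and> adj S = S \<and> (\<forall>A\<in>D. loewner_le A S) \<and>
        (\<forall>B\<in>M. adj B = B \<and> (\<forall>A\<in>D. loewner_le A B) \<longrightarrow> loewner_le S B)
        \<longrightarrow> bdd_above ((\<lambda>A. Re (\<tau> A)) ` D) \<and> Re (\<tau> S) = (SUP A\<in>D. Re (\<tau> A)))"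

text \<open>On a factor such a functional is unique, so a finite factor has exactly one.\<close>

definition fn_tracial_state :: "('h::chilbert_space \<Rightarrow>\<^sub>L 'h) set \<Rightarrow> (('h \<Rightarrow>\<^sub>L 'h) \<Rightarrow> complex) \<Rightarrow> bool" where
  "fn_tracial_state M \<tau> \<longleftrightarrow> tracial_state M \<tau> \<and> faithful_on M \<tau> \<and> normal_on M \<tau>"

definition finite_factor :: "('h::chilbert_space \<Rightarrow>\<^sub>L 'h) set \<Rightarrow> bool" where
  "finite_factor M \<longleftrightarrow> factor M \<and> (\<exists>\<tau>. fn_tracial_state M \<tau>)"

definition projections_of_trace ::
  "('h::chilbert_space \<Rightarrow>\<^sub>L 'h) set \<Rightarrow> (('h \<Rightarrow>\<^sub>L 'h) \<Rightarrow> complex) \<Rightarrow> real \<Rightarrow> ('h \<Rightarrow>\<^sub>L 'h) set" where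
  "projections_of_trace M \<tau> r = {P \<in> M. is_projection P \<and> \<tau> P = complex_of_real r}"

definition spectrum :: "('h::chilbert_space \<Rightarrow>\<^sub>L 'h) \<Rightarrow> complex set" where
  "spectrum A = {z. \<not> (\<exists>B\<in>bounded_ops. (A - scalar_op z) o\<^sub>L B = id_blinfun \<and>
                                   B o\<^sub>L (A - scalar_op z) = id_blinfun)}"

definition poly_op :: "real poly \<Rightarrow> ('h::chilbert_space \<Rightarrow>\<^sub>L 'h) \<Rightarrow> ('h \<Rightarrow>\<^sub>L 'h)" where
  "poly_op q A = (\<Sum>i\<le>degree q. coeff q i *\<^sub>R (((o\<^sub>L) A ^^ i) id_blinfun))"

text \<open>Continuous functional calculus: for self-adjoint \<open>A\<close> (whose spectrum is real) and real \<open>f\<close>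
  continuous on the spectrum, \<open>f(A)\<close> is the norm limit of \<open>q\<^sub>n(A)\<close> for every sequence of
  polynomials \<open>q\<^sub>n\<close> that converges to \<open>f\<close> uniformly on the spectrum.  Meaningless for other \<open>A\<close>, \<open>f\<close>.\<close>

definition cfc :: "(real \<Rightarrow> real) \<Rightarrow> ('h::chilbert_space \<Rightarrow>\<^sub>L 'h) \<Rightarrow> ('h \<Rightarrow>\<^sub>L 'h)" where
  "cfc f A = (THE B. \<forall>q. uniform_limit {t. complex_of_real t \<in> spectrum A} (\<lambda>n. poly (q n)) f sequentially
                        \<longrightarrow> (\<lambda>n. poly_op (q n) A) \<longlonglongrightarrow> B)"

definition abs_op :: "('h::chilbert_space \<Rightarrow>\<^sub>L 'h) \<Rightarrow> ('h \<Rightarrow>\<^sub>L 'h)" where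
  "abs_op A = cfc sqrt (adj A o\<^sub>L A)"

definition p_norm :: "(('h::chilbert_space \<Rightarrow>\<^sub>L 'h) \<Rightarrow> complex) \<Rightarrow> real \<Rightarrow> ('h \<Rightarrow>\<^sub>L 'h) \<Rightarrow> real" where
  "p_norm \<tau> p A = (Re (\<tau> (cfc (\<lambda>t. t powr p) (abs_op A)))) powr (1 / p)"

end

theory Submission
  imports Defs "HOL-Computational_Algebra.Fundamental_Theorem_Algebra"
begin

text \<open>With \<open>X = (P - Q)\<^sup>2\<close> one has \<open>(I - P - Q)\<^sup>2 = I - X\<close>, so both norm conditions say
  \<open>\<tau>(X\<^bsup>s\<^esup>) = \<tau>((I - X)\<^bsup>s\<^esup>) = 2\<^bsup>-s\<^esup>\<close> for \<open>s = p/2\<close>.  By strict convexity (\<open>s > 1\<close>) or concavity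
  (\<open>s < 1\<close>), \<open>t\<^bsup>s\<^esup> + (1 - t)\<^bsup>s\<^esup> - 2 \<cdot> 2\<^bsup>-s\<^esup>\<close> has a constant sign on \<open>[0, 1]\<close> and vanishes only at
  \<open>t = 1/2\<close>; since \<open>\<tau>\<close> is faithful, \<open>X = I/2\<close>.  This is equivalent to the existence of \<open>U\<close>, namely
  \<open>U = 2QP - P\<close>.

  The functional calculus rests on the bound of \<open>\<parallel>q(A)\<parallel>\<close> by the supremum of \<open>\<bar>q\<bar>\<close> on the spectrum for
  self-adjoint \<open>A\<close> and real polynomials \<open>q\<close>.  If \<open>d = \<parallel>q(A)\<parallel>\<close>, then \<open>q(A)\<^sup>2 - d\<^sup>2\<close> is not bounded
  below, hence not invertible.  Factor \<open>q\<^sup>2 - d\<^sup>2\<close> over the reals: the quadratic factors are invertible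
  at \<open>A\<close>, so some root \<open>t\<close> lies in the spectrum, and \<open>\<bar>q(t)\<bar> = d\<close>.\<close>

section \<open>Riesz representation and adjoints\<close>

theorem riesz_representation:
  fixes f :: "'a::{real_inner,complete_space} \<Rightarrow> real"
  assumes f: "bounded_linear f"
  obtains z where "\<And>x. f x = x \<bullet> z"
proof -
  interpret bounded_linear f by (rule f)
  define J where "J x = x \<bullet> x - 2 * f x" for x
  obtain K where K: "\<And>x. norm (f x) \<le> norm x * K"
    using bounded by blast
  have J_ge: "J x \<ge> - K\<^sup>2" for x
  proof -
    have "f x \<le> norm x * K"
      using K[of x] by simp
    moreover have "0 \<le> (norm x - K)\<^sup>2" by simp
    ultimately show ?thesis
      unfolding J_def by (simp add: power2_diff power2_norm_eq_inner)
  qed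
  then have bdd: "bdd_below (range J)"
    by (intro bdd_belowI[of _ "- K\<^sup>2"]) auto
  define d where "d = Inf (range J)"
  have d_le: "d \<le> J x" for x
    unfolding d_def by (intro cInf_lower bdd) auto
  have "\<exists>x. J x < d + 1 / real (Suc n)" for n
    using cInf_lessD[of "range J" "d + 1 / real (Suc n)"] by (auto simp: d_def)
  then obtain X where X: "\<And>n. J (X n) < d + 1 / real (Suc n)"
    by metis
  \<comment> \<open>the parallelogram identity makes a minimizing sequence of \<open>J\<close> Cauchy\<close>
  have para: "(norm (x - y))\<^sup>2 \<le> 2 * (J x - d) + 2 * (J y - d)" for x y
  proof -
    have "(norm (x - y))\<^sup>2 = 2 * J x + 2 * J y - 4 * J ((1/2) *\<^sub>R (x + y))"
      unfolding J_def power2_norm_eq_inner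
      by (simp add: scaleR add inner_simps inner_commute algebra_simps)
    then show ?thesis
      using d_le[of "(1/2) *\<^sub>R (x + y)"] by simp
  qed
  have "Cauchy X"
  proof (rule metric_CauchyI)
    fix e :: real
    assume "e > 0"
    then obtain N where N: "1 / real (Suc N) < e\<^sup>2 / 4"
      using reals_Archimedean[of "e\<^sup>2 / 4"] by (auto simp: inverse_eq_divide)
    have small: "J (X n) - d < e\<^sup>2 / 4" if "n \<ge> N" for n
    proof -
      have "1 / real (Suc n) \<le> 1 / real (Suc N)"
        using that by (simp add: frac_le)
      then show ?thesis
        using X[of n] N by linarith
    qed
    have "dist (X m) (X n) < e" if "m \<ge> N" "n \<ge> N" for m n
    proof -
      have "(norm (X m - X n))\<^sup>2 < e\<^sup>2"
        using para[of "X m" "X n"] add_strict_mono[OF small[OF that(1)] small[OF that(2)]]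
        by (simp add: field_simps)
      then show ?thesis
        using \<open>e > 0\<close> by (simp add: dist_norm power2_less_imp_less)
    qed
    then show "\<exists>N. \<forall>m\<ge>N. \<forall>n\<ge>N. dist (X m) (X n) < e"
      by blast
  qed
  then obtain z where z: "X \<longlonglongrightarrow> z"
    using Cauchy_convergent convergentD by blast
  have "(\<lambda>n. J (X n)) \<longlonglongrightarrow> J z"
    unfolding J_def by (intro tendsto_intros z tendsto)
  moreover have "(\<lambda>n. d + 1 / real (Suc n)) \<longlonglongrightarrow> d + 0"
    by (intro tendsto_intros LIMSEQ_Suc[OF lim_1_over_n])
  ultimately have "J z \<le> d + 0"
    by (rule LIMSEQ_le) (use X less_imp_le in blast)
  then have min: "J z \<le> J x" for x
    using d_le[of x] by simp
  have "f x = x \<bullet> z" for x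
  proof (cases "x = 0")
    case True
    then show ?thesis by (simp add: zero)
  next
    case False
    define a where "a = x \<bullet> z - f x"
    define t where "t = - a / (x \<bullet> x)"
    have xx: "x \<bullet> x > 0" using False by simp
    have "J (z + t *\<^sub>R x) = J z + 2 * t * a + t\<^sup>2 * (x \<bullet> x)"
      unfolding J_def a_def
      by (simp add: add scaleR inner_simps inner_commute algebra_simps power2_eq_square)
    then have "0 \<le> 2 * t * a + t\<^sup>2 * (x \<bullet> x)"
      using min[of "z + t *\<^sub>R x"] by simp
    also have "\<dots> = - (a\<^sup>2) / (x \<bullet> x)"
      unfolding t_def using xx by (simp add: field_simps power2_eq_square)
    finally have "a\<^sup>2 \<le> 0"
      using xx by (simp add: field_simps)
    then have "a = 0" by simp
    then show ?thesis by (simp add: a_def)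
  qed
  then show ?thesis using that by blast
qed

lemma bounded_opsD: "(T :: _ \<Rightarrow>\<^sub>L _) \<in> bounded_ops \<Longrightarrow> T (c *\<^sub>C x) = c *\<^sub>C T x"
  by (simp add: bounded_ops_def)

lemma cinner_eq_inner: "cinner x y = Complex (x \<bullet> y) (- ((\<i> *\<^sub>C x) \<bullet> y))"
  by (simp add: complex_eq_iff Re_cinner cinner_scaleC_left flip: Re_cinner)

lemma scaleC_eq: "c *\<^sub>C x = Re c *\<^sub>R x + Im c *\<^sub>R (\<i> *\<^sub>C x)"
proof -
  have "c = complex_of_real (Re c) + complex_of_real (Im c) * \<i>"
    by (simp add: complex_eq_iff)
  then have "c *\<^sub>C x = (complex_of_real (Re c) + complex_of_real (Im c) * \<i>) *\<^sub>C x"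
    by simp
  also have "\<dots> = Re c *\<^sub>R x + Im c *\<^sub>R (\<i> *\<^sub>C x)"
    by (simp only: scaleC_add_left scaleC_of_real flip: scaleC_scaleC)
  finally show ?thesis .
qed

lemma scaleC_scaleR: "c *\<^sub>C (r *\<^sub>R x) = r *\<^sub>R (c *\<^sub>C x)"
  by (metis scaleC_of_real scaleC_scaleC mult.commute)

lemma scaleC_diff_right: "c *\<^sub>C (x - y) = c *\<^sub>C x - c *\<^sub>C y"
  by (metis scaleC_add_right diff_add_cancel add_diff_cancel_right')

lemma bounded_opsI:
  fixes T :: "'h::chilbert_space \<Rightarrow>\<^sub>L 'h"
  assumes "\<And>x. T (\<i> *\<^sub>C x) = \<i> *\<^sub>C T x"
  shows "T \<in> bounded_ops"
proof -
  have "T (c *\<^sub>C x) = c *\<^sub>C T x" for c x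
    by (subst (1 2) scaleC_eq) (simp add: assms blinfun.bilinear_simps)
  then show ?thesis by (simp add: bounded_ops_def)
qed

definition adjoint_pair :: "('h::chilbert_space \<Rightarrow>\<^sub>L 'h) \<Rightarrow> ('h \<Rightarrow>\<^sub>L 'h) \<Rightarrow> bool" where
  "adjoint_pair T S \<longleftrightarrow> (\<forall>x y. T x \<bullet> y = x \<bullet> S y)"

lemma adjoint_pairD: "adjoint_pair T S \<Longrightarrow> T x \<bullet> y = x \<bullet> S y"
  by (simp add: adjoint_pair_def)

lemma adjoint_pair_unique:
  assumes "adjoint_pair T S" "adjoint_pair T S'"
  shows "S = S'"
proof (rule blinfun_eqI)
  fix y
  have "x \<bullet> (S y - S' y) = 0" for x
    using assms by (simp add: adjoint_pair_def inner_diff_right)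
  then show "S y = S' y"
    by (metis inner_eq_zero_iff right_minus_eq)
qed

lemma adjoint_pair_iff_cinner:
  assumes "T \<in> bounded_ops"
  shows "adjoint_pair T S \<longleftrightarrow> (\<forall>x y. cinner (T x) y = cinner x (S y))"
proof
  assume "adjoint_pair T S"
  then show "\<forall>x y. cinner (T x) y = cinner x (S y)"
    by (simp add: cinner_eq_inner bounded_opsD[OF assms, symmetric] adjoint_pair_def)
next
  assume "\<forall>x y. cinner (T x) y = cinner x (S y)"
  then show "adjoint_pair T S"
    by (simp add: adjoint_pair_def flip: Re_cinner)
qed

lemma adjoint_pair_exists: "\<exists>S. adjoint_pair T S" for T :: "'h::chilbert_space \<Rightarrow>\<^sub>L 'h"
proof -
  have "\<exists>z. \<forall>x. T x \<bullet> y = x \<bullet> z" for y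
  proof -
    have "bounded_linear (\<lambda>x. T x \<bullet> y)"
      by (intro bounded_linear_intros)
    then show ?thesis
      using riesz_representation by metis
  qed
  then obtain S where S: "\<And>x y. T x \<bullet> y = x \<bullet> S y"
    by metis
  have eqI: "u = v" if "\<And>x. x \<bullet> u = x \<bullet> v" for u v :: 'h
    using that by (metis inner_diff_right inner_eq_zero_iff right_minus_eq)
  have "bounded_linear S"
  proof (rule bounded_linear_intro)
    show "S (x + y) = S x + S y" for x y
      by (rule eqI) (simp add: inner_add_right flip: S)
    show "S (r *\<^sub>R x) = r *\<^sub>R S x" for r x
      by (rule eqI) (simp flip: S)
    show "norm (S x) \<le> norm x * norm T" for x
    proof -
      have "(norm (S x))\<^sup>2 = T (S x) \<bullet> x"
        by (simp add: S power2_norm_eq_inner)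
      also have "\<dots> \<le> norm (T (S x)) * norm x"
        by (rule norm_cauchy_schwarz)
      also have "\<dots> \<le> norm T * norm (S x) * norm x"
        by (intro mult_right_mono norm_blinfun norm_ge_zero)
      finally have "norm (S x) * norm (S x) \<le> norm (S x) * (norm x * norm T)"
        by (simp add: power2_eq_square mult_ac)
      then show ?thesis
        by (cases "S x = 0") auto
    qed
  qed
  then have "adjoint_pair T (Blinfun S)"
    by (simp add: adjoint_pair_def bounded_linear_Blinfun_apply S)
  then show ?thesis ..
qed

lemma adj_eqI:
  assumes "T \<in> bounded_ops" "adjoint_pair T S"
  shows "adj T = S"
  unfolding adj_def
  using assms adjoint_pair_unique by (auto simp flip: adjoint_pair_iff_cinner[OF assms(1)])

lemma adjoint_pair_adj: "T \<in> bounded_ops \<Longrightarrow> adjoint_pair T (adj T)"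
  using adjoint_pair_exists adj_eqI by metis

lemma inner_adj: "(T :: _ \<Rightarrow>\<^sub>L _) \<in> bounded_ops \<Longrightarrow> T x \<bullet> y = x \<bullet> adj T y"
  using adjoint_pair_adj adjoint_pairD by blast

lemma bounded_ops_closed_intros:
  "id_blinfun \<in> bounded_ops"
  "S \<in> bounded_ops \<Longrightarrow> T \<in> bounded_ops \<Longrightarrow> S + T \<in> bounded_ops"
  "S \<in> bounded_ops \<Longrightarrow> T \<in> bounded_ops \<Longrightarrow> S - T \<in> bounded_ops"
  "S \<in> bounded_ops \<Longrightarrow> T \<in> bounded_ops \<Longrightarrow> S o\<^sub>L T \<in> bounded_ops"
  "S \<in> bounded_ops \<Longrightarrow> r *\<^sub>R S \<in> bounded_ops"
  by (auto intro!: bounded_opsI simp: bounded_opsD blinfun.bilinear_simps scaleC_add_right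
      scaleC_diff_right scaleC_scaleR)

section \<open>Invertibility of coercive operators\<close>

definition invertible_op :: "('h::chilbert_space \<Rightarrow>\<^sub>L 'h) \<Rightarrow> bool" where
  "invertible_op T \<longleftrightarrow> (\<exists>B\<in>bounded_ops. T o\<^sub>L B = id_blinfun \<and> B o\<^sub>L T = id_blinfun)"

lemma invertible_opI_coercive:
  assumes T: "T \<in> bounded_ops" and m: "m > 0" and coercive: "\<And>x. m * (x \<bullet> x) \<le> T x \<bullet> x"
  shows "invertible_op T"
proof -
  have lower: "m * norm x \<le> norm (T x)" for x
  proof (cases "x = 0")
    case False
    have "m * norm x * norm x \<le> norm (T x) * norm x"
      using coercive[of x] norm_cauchy_schwarz[of "T x" x]
      by (simp add: mult.assoc flip: power2_norm_eq_inner power2_eq_square)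
    then show ?thesis using False by simp
  qed simp
  have inj: "x = y" if "T x = T y" for x y
    using lower[of "x - y"] m that by (simp add: blinfun.diff_right mult_le_0_iff)
  \<comment> \<open>for small \<open>s\<close> the map \<open>x \<mapsto> x - s (T x - y)\<close> is a contraction\<close>
  have surj: "\<exists>x. T x = y" for y
  proof -
    define K where "K = norm T + m"
    have K: "K > 0" "K \<ge> m" using m by (auto simp: K_def add_nonneg_pos)
    define s where "s = m / K\<^sup>2"
    define c where "c = sqrt (1 - m\<^sup>2 / K\<^sup>2)"
    have s: "s > 0" using m K by (simp add: s_def)
    have frac: "m\<^sup>2 / K\<^sup>2 \<le> 1" "m\<^sup>2 / K\<^sup>2 > 0"
      using m K by (auto simp: power_mono)
    have c: "0 \<le> c" "c < 1"
      using frac by (auto simp: c_def real_sqrt_lt_1_iff)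
    have contr: "norm (x - s *\<^sub>R T x) \<le> c * norm x" for x
    proof -
      have "norm (T x) \<le> K * norm x"
        using norm_blinfun[of T x] m by (simp add: K_def distrib_right add_increasing2)
      then have "(norm (T x))\<^sup>2 \<le> (K * norm x)\<^sup>2"
        by (rule power_mono) simp
      then have 1: "s\<^sup>2 * (T x \<bullet> T x) \<le> s\<^sup>2 * (K\<^sup>2 * (x \<bullet> x))"
        by (intro mult_left_mono) (simp_all add: power2_norm_eq_inner power_mult_distrib)
      have 2: "s * (m * (x \<bullet> x)) \<le> s * (T x \<bullet> x)"
        using s coercive[of x] by simp
      have "(norm (x - s *\<^sub>R T x))\<^sup>2 = x \<bullet> x - 2 * (s * (T x \<bullet> x)) + s\<^sup>2 * (T x \<bullet> T x)"
        unfolding power2_norm_eq_inner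
        by (simp add: inner_simps inner_commute algebra_simps power2_eq_square)
      also have "\<dots> \<le> x \<bullet> x - 2 * (s * (m * (x \<bullet> x))) + s\<^sup>2 * (K\<^sup>2 * (x \<bullet> x))"
        using 1 2 by linarith
      also have "\<dots> = (1 - m\<^sup>2 / K\<^sup>2) * (x \<bullet> x)"
        using K by (simp add: s_def field_simps power2_eq_square)
      also have "\<dots> = (c * norm x)\<^sup>2"
        using frac by (simp add: c_def power_mult_distrib power2_norm_eq_inner)
      finally show ?thesis
        using c by (simp add: power2_le_iff_abs_le)
    qed
    have "dist (x - s *\<^sub>R (T x - y)) (x' - s *\<^sub>R (T x' - y)) \<le> c * dist x x'" for x x'
      using contr[of "x - x'"] by (simp add: dist_norm blinfun.diff_right algebra_simps)
    then have "\<exists>!x. x - s *\<^sub>R (T x - y) = x"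
      using banach_fix_type[OF c, of "\<lambda>x. x - s *\<^sub>R (T x - y)"] by blast
    then show ?thesis using s by auto
  qed
  obtain g where g: "\<And>y. T (g y) = y"
    using surj by metis
  have "bounded_linear g"
  proof (rule bounded_linear_intro)
    show "g (x + y) = g x + g y" for x y
      by (rule inj) (simp add: g blinfun.bilinear_simps)
    show "g (r *\<^sub>R x) = r *\<^sub>R g x" for r x
      by (rule inj) (simp add: g blinfun.bilinear_simps)
    show "norm (g x) \<le> norm x * (1 / m)" for x
      using lower[of "g x"] m by (simp add: g field_simps)
  qed
  then have B: "Blinfun g x = g x" for x
    by (simp add: bounded_linear_Blinfun_apply)
  have "Blinfun g \<in> bounded_ops"
    by (rule bounded_opsI, rule inj) (simp add: B g bounded_opsD[OF T])
  moreover have "T o\<^sub>L Blinfun g = id_blinfun"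
    by (rule blinfun_eqI) (simp add: B g)
  moreover have "Blinfun g o\<^sub>L T = id_blinfun"
    by (rule blinfun_eqI, rule inj) (simp add: B g)
  ultimately show ?thesis
    unfolding invertible_op_def by blast
qed

lemma invertible_op_compose:
  assumes "invertible_op S" "invertible_op T"
  shows "invertible_op (S o\<^sub>L T)"
proof -
  obtain B C where B: "B \<in> bounded_ops" "S o\<^sub>L B = id_blinfun" "B o\<^sub>L S = id_blinfun"
    and C: "C \<in> bounded_ops" "T o\<^sub>L C = id_blinfun" "C o\<^sub>L T = id_blinfun"
    using assms unfolding invertible_op_def by metis
  have "S (B x) = x" "B (S x) = x" "T (C x) = x" "C (T x) = x" for x
    using B C by (metis blinfun_apply_blinfun_compose blinfun_apply_id_blinfun)+
  then have "(S o\<^sub>L T) o\<^sub>L (C o\<^sub>L B) = id_blinfun" "(C o\<^sub>L B) o\<^sub>L (S o\<^sub>L T) = id_blinfun"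
    by (auto intro!: blinfun_eqI)
  then show ?thesis
    using B C bounded_ops_closed_intros(4) unfolding invertible_op_def by blast
qed

lemma invertible_op_factor:
  assumes "S \<in> bounded_ops" "T \<in> bounded_ops" "S o\<^sub>L T = T o\<^sub>L S" "invertible_op (S o\<^sub>L T)"
  shows "invertible_op S"
proof -
  obtain R where R: "R \<in> bounded_ops" "(S o\<^sub>L T) o\<^sub>L R = id_blinfun" "R o\<^sub>L (S o\<^sub>L T) = id_blinfun"
    using assms(4) unfolding invertible_op_def by metis
  have 1: "S (T (R x)) = x" for x
    using R(2) by (metis blinfun_apply_blinfun_compose blinfun_apply_id_blinfun)
  have 2: "R (T (S x)) = x" for x
    using R(3) assms(3) by (metis blinfun_apply_blinfun_compose blinfun_apply_id_blinfun)
  have "T (R (S x)) = x" for x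
    using 1 2 by metis
  then have "S o\<^sub>L (T o\<^sub>L R) = id_blinfun" "(T o\<^sub>L R) o\<^sub>L S = id_blinfun"
    using 1 by (auto intro!: blinfun_eqI)
  moreover have "T o\<^sub>L R \<in> bounded_ops"
    using assms(2) R(1) by (rule bounded_ops_closed_intros)
  ultimately show ?thesis
    unfolding invertible_op_def by blast
qed

lemma invertible_op_scaleR: "c \<noteq> 0 \<Longrightarrow> invertible_op (c *\<^sub>R id_blinfun)"
  unfolding invertible_op_def
  by (rule bexI[of _ "(1/c) *\<^sub>R id_blinfun"])
    (auto intro!: blinfun_eqI bounded_ops_closed_intros simp: blinfun.bilinear_simps)

lemma scalar_op_of_real: "scalar_op (complex_of_real t) = t *\<^sub>R id_blinfun"
  by (rule blinfun_eqI) (simp add: scalar_op.rep_eq scaleC_of_real blinfun.bilinear_simps)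

lemma of_real_in_spectrum_iff:
  "complex_of_real t \<in> spectrum A \<longleftrightarrow> \<not> invertible_op (A - t *\<^sub>R id_blinfun)"
  by (simp add: spectrum_def invertible_op_def scalar_op_of_real)

section \<open>Polynomials in a self-adjoint operator\<close>

lemma poly_op_altdef:
  assumes "degree q \<le> n"
  shows "poly_op q A = (\<Sum>i\<le>n. coeff q i *\<^sub>R (((o\<^sub>L) A ^^ i) id_blinfun))"
  unfolding poly_op_def using assms
  by (intro sum.mono_neutral_left) (auto simp: coeff_eq_0)

lemma poly_op_pCons: "poly_op (pCons a q) A = a *\<^sub>R id_blinfun + (A o\<^sub>L poly_op q A)"
proof -
  have "poly_op (pCons a q) A =
      (\<Sum>i\<le>Suc (degree q). coeff (pCons a q) i *\<^sub>R (((o\<^sub>L) A ^^ i) id_blinfun))"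
    by (rule poly_op_altdef) (simp add: degree_pCons_le)
  also have "\<dots> = a *\<^sub>R id_blinfun +
      (\<Sum>i\<le>degree q. coeff q i *\<^sub>R (A o\<^sub>L ((o\<^sub>L) A ^^ i) id_blinfun))"
    by (subst sum.atMost_Suc_shift) simp
  also have "(\<Sum>i\<le>degree q. coeff q i *\<^sub>R (A o\<^sub>L ((o\<^sub>L) A ^^ i) id_blinfun)) =
      A o\<^sub>L poly_op q A"
    unfolding poly_op_def
    by (simp add: bounded_bilinear.sum_right[OF bounded_bilinear_blinfun_compose]
        bounded_bilinear.scaleR_right[OF bounded_bilinear_blinfun_compose])
  finally show ?thesis .
qed

lemma poly_op_0 [simp]: "poly_op 0 A = 0"
  by (simp add: poly_op_def)

lemma poly_op_const [simp]: "poly_op [:a:] A = a *\<^sub>R id_blinfun"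
  by (simp add: poly_op_pCons)

lemma poly_op_X: "poly_op [:0, 1:] A = A"
  by (rule blinfun_eqI) (simp add: poly_op_pCons blinfun.bilinear_simps)

lemma poly_op_add: "poly_op (p + q) A = poly_op p A + poly_op q A"
  by (induction p q rule: poly_induct2)
    (auto intro!: blinfun_eqI simp: poly_op_pCons blinfun.bilinear_simps algebra_simps)

lemma poly_op_smult: "poly_op (smult c q) A = c *\<^sub>R poly_op q A"
  by (induction q)
    (auto intro!: blinfun_eqI simp: poly_op_pCons blinfun.bilinear_simps algebra_simps)

lemma poly_op_diff: "poly_op (p - q) A = poly_op p A - poly_op q A"
  using poly_op_add[of "p - q" q A] by simp

lemma poly_op_mult: "poly_op (p * q) A = poly_op p A o\<^sub>L poly_op q A"
  by (induction p)
    (auto intro!: blinfun_eqI simp: poly_op_pCons poly_op_add poly_op_smult blinfun.bilinear_simps)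

lemma poly_op_commute: "poly_op p A o\<^sub>L poly_op q A = poly_op q A o\<^sub>L poly_op p A"
  by (metis poly_op_mult mult.commute)

definition closed_op_algebra :: "('h::chilbert_space \<Rightarrow>\<^sub>L 'h) set \<Rightarrow> bool" where
  "closed_op_algebra M \<longleftrightarrow> closed M \<and> id_blinfun \<in> M \<and>
     (\<forall>S\<in>M. \<forall>T\<in>M. S + T \<in> M \<and> S o\<^sub>L T \<in> M) \<and> (\<forall>S\<in>M. \<forall>r::real. r *\<^sub>R S \<in> M)"

lemma closed_op_algebraD:
  assumes "closed_op_algebra M"
  shows "closed M" "id_blinfun \<in> M" "S \<in> M \<Longrightarrow> T \<in> M \<Longrightarrow> S + T \<in> M"
    "S \<in> M \<Longrightarrow> T \<in> M \<Longrightarrow> S o\<^sub>L T \<in> M" "S \<in> M \<Longrightarrow> r *\<^sub>R S \<in> M"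
    "S \<in> M \<Longrightarrow> T \<in> M \<Longrightarrow> S - T \<in> M"
proof -
  show "S - T \<in> M" if "S \<in> M" "T \<in> M"
  proof -
    have "S + (-1) *\<^sub>R T \<in> M"
      using assms that unfolding closed_op_algebra_def by blast
    then show ?thesis by simp
  qed
qed (use assms in \<open>auto simp: closed_op_algebra_def\<close>)

lemma poly_op_in_closed_op_algebra:
  assumes "closed_op_algebra M" "A \<in> M"
  shows "poly_op q A \<in> M"
proof (induction q)
  case 0
  then show ?case
    using closed_op_algebraD(5)[OF assms, of 0] by simp
next
  case (pCons a q)
  then show ?case
    unfolding poly_op_pCons using assms pCons.IH by (intro closed_op_algebraD)
qed

lemma bounded_linear_scaleC: "bounded_linear (\<lambda>x. c *\<^sub>C (x :: 'h::chilbert_space))"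
  by (rule bounded_linear_intro[where K = "cmod c"])
    (simp_all add: scaleC_add_right scaleC_scaleR norm_scaleC mult.commute)

lemma closed_op_algebra_bounded_ops: "closed_op_algebra (bounded_ops :: ('h::chilbert_space \<Rightarrow>\<^sub>L 'h) set)"
proof -
  have "closed {A :: 'h \<Rightarrow>\<^sub>L 'h. A (c *\<^sub>C x) = c *\<^sub>C A x}" for c x
    by (intro closed_Collect_eq bounded_linear.continuous_on[OF bounded_linear_scaleC] continuous_intros)
  then have "closed (\<Inter>c x. {A :: 'h \<Rightarrow>\<^sub>L 'h. A (c *\<^sub>C x) = c *\<^sub>C A x})"
    by (intro closed_INT ballI)
  moreover have "bounded_ops = (\<Inter>c x. {A :: 'h \<Rightarrow>\<^sub>L 'h. A (c *\<^sub>C x) = c *\<^sub>C A x})"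
    by (auto simp: bounded_ops_def)
  ultimately show ?thesis
    by (simp add: closed_op_algebra_def bounded_ops_closed_intros)
qed

definition selfadjoint_op :: "('h::chilbert_space \<Rightarrow>\<^sub>L 'h) \<Rightarrow> bool" where
  "selfadjoint_op A \<longleftrightarrow> A \<in> bounded_ops \<and> adjoint_pair A A"

lemma selfadjoint_opD:
  assumes "selfadjoint_op A"
  shows "A \<in> bounded_ops" "A x \<bullet> y = x \<bullet> A y" "adj A = A"
  using assms adj_eqI by (auto simp: selfadjoint_op_def adjoint_pair_def)

lemma selfadjoint_opI:
  fixes A :: "'h::chilbert_space \<Rightarrow>\<^sub>L 'h"
  shows "A \<in> bounded_ops \<Longrightarrow> (\<And>x y. A x \<bullet> y = x \<bullet> A y) \<Longrightarrow> selfadjoint_op A"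
  by (simp add: selfadjoint_op_def adjoint_pair_def)

lemma closed_selfadjoint_op: "closed {A :: 'h::chilbert_space \<Rightarrow>\<^sub>L 'h. selfadjoint_op A}"
proof -
  have "{A :: 'h \<Rightarrow>\<^sub>L 'h. selfadjoint_op A} = bounded_ops \<inter> (\<Inter>x y. {A :: 'h \<Rightarrow>\<^sub>L 'h. A x \<bullet> y = x \<bullet> A y})"
    by (auto simp: selfadjoint_op_def adjoint_pair_def)
  moreover have "closed {A :: 'h \<Rightarrow>\<^sub>L 'h. A x \<bullet> y = x \<bullet> A y}" for x y
    by (intro closed_Collect_eq continuous_intros)
  ultimately show ?thesis
    using closed_op_algebraD(1)[OF closed_op_algebra_bounded_ops] by (auto intro!: closed_Int closed_INT)
qed

lemma poly_op_bounded_ops: "A \<in> bounded_ops \<Longrightarrow> poly_op q A \<in> bounded_ops"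
  by (rule poly_op_in_closed_op_algebra[OF closed_op_algebra_bounded_ops])

lemma poly_op_selfadjoint:
  assumes "selfadjoint_op A"
  shows "selfadjoint_op (poly_op q A)"
proof (rule selfadjoint_opI)
  show "poly_op q A x \<bullet> y = x \<bullet> poly_op q A y" for x y
  proof (induction q arbitrary: x y)
    case (pCons a q)
    have "poly_op q A (A x) = A (poly_op q A x)"
      using poly_op_commute[of q A "[:0,1:]"] unfolding poly_op_X
      by (metis blinfun_apply_blinfun_compose)
    then have "A (poly_op q A x) \<bullet> y = A x \<bullet> poly_op q A y"
      using pCons.IH[of "A x" y] by simp
    also have "\<dots> = x \<bullet> A (poly_op q A y)"
      by (rule selfadjoint_opD[OF assms])
    finally show ?case
      by (simp add: poly_op_pCons blinfun.bilinear_simps inner_simps)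
  qed simp
qed (use assms in \<open>auto intro: poly_op_bounded_ops simp: selfadjoint_op_def\<close>)

lemma map_poly_of_real_add:
  "map_poly complex_of_real (p + q) = map_poly complex_of_real p + map_poly complex_of_real q"
  by (rule poly_eqI) (simp add: coeff_map_poly)

lemma map_poly_of_real_mult:
  "map_poly complex_of_real (p * q) = map_poly complex_of_real p * map_poly complex_of_real q"
  by (induction p) (simp_all add: map_poly_of_real_add map_poly_smult map_poly_pCons)

lemma poly_map_poly_of_real:
  "poly (map_poly complex_of_real p) (complex_of_real t) = complex_of_real (poly p t)"
  by (induction p) (simp_all add: map_poly_pCons)

lemma real_quadratic_factor:
  fixes r :: "real poly"
  assumes "poly (map_poly complex_of_real r) z = 0" and "Im z \<noteq> 0"
  shows "[:(cmod z)\<^sup>2, - 2 * Re z, 1:] dvd r"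
proof -
  define s where "s = [:(cmod z)\<^sup>2, - 2 * Re z, 1:]"
  have "z * z - 2 * complex_of_real (Re z) * z + complex_of_real ((cmod z)\<^sup>2) = 0"
    using cmod_power2[of z] by (simp add: complex_eq_iff power2_eq_square)
  then have root: "poly (map_poly complex_of_real s) z = 0"
    by (simp add: s_def map_poly_pCons algebra_simps)
  have "degree s = 2" "s \<noteq> 0"
    by (auto simp: s_def)
  then have deg: "degree (r mod s) \<le> 1"
    using degree_mod_less[of s r] by auto
  then obtain u v where uv: "r mod s = [:u, v:]"
    by (metis One_nat_def degree_0 degree_pCons_eq_if le_zero_eq not_less_eq_eq pCons_cases
        Suc_le_mono degree_eq_zeroE)
  have "poly (map_poly complex_of_real (s * (r div s) + r mod s)) z = 0"
    using assms(1) by simp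
  then have "complex_of_real u + z * complex_of_real v = 0"
    unfolding map_poly_of_real_add map_poly_of_real_mult uv
    by (simp add: root map_poly_pCons)
  then have "u = 0" "v = 0"
    using assms(2) by (auto simp: complex_eq_iff)
  then show ?thesis
    using uv unfolding s_def by (simp add: mod_eq_0_iff_dvd)
qed

lemma poly_op_linear: "poly_op [:- t, 1:] A = A - t *\<^sub>R id_blinfun"
  by (rule blinfun_eqI) (simp add: poly_op_pCons blinfun.bilinear_simps)

lemma invertible_op_quadratic:
  assumes A: "selfadjoint_op A" and "Im z \<noteq> 0"
  shows "invertible_op (poly_op [:(cmod z)\<^sup>2, - 2 * Re z, 1:] A)"
proof (rule invertible_opI_coercive)
  show "poly_op [:(cmod z)\<^sup>2, - 2 * Re z, 1:] A \<in> bounded_ops"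
    using A by (intro poly_op_bounded_ops selfadjoint_opD)
  show "(Im z)\<^sup>2 > 0" using assms(2) by simp
  show "(Im z)\<^sup>2 * (x \<bullet> x) \<le> poly_op [:(cmod z)\<^sup>2, - 2 * Re z, 1:] A x \<bullet> x" for x
  proof -
    have "poly_op [:(cmod z)\<^sup>2, - 2 * Re z, 1:] A x \<bullet> x =
        (Im z)\<^sup>2 * (x \<bullet> x) + (A x - Re z *\<^sub>R x) \<bullet> (A x - Re z *\<^sub>R x)"
      using selfadjoint_opD(2)[OF A, of "A x" x]
      unfolding cmod_power2
      by (simp add: poly_op_pCons blinfun.bilinear_simps inner_simps algebra_simps
          power2_eq_square inner_commute)
    then show ?thesis by simp
  qed
qed

lemma invertible_poly_op:
  assumes A: "selfadjoint_op A"
  shows "r \<noteq> 0 \<Longrightarrow> (\<And>t. complex_of_real t \<in> spectrum A \<Longrightarrow> poly r t \<noteq> 0) \<Longrightarrow>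
    invertible_op (poly_op r A)"
proof (induction "degree r" arbitrary: r rule: less_induct)
  case less
  show ?case
  proof (cases "degree r = 0")
    case True
    then obtain c where "r = [:c:]"
      by (metis degree_eq_zeroE)
    then show ?thesis
      using less.prems by (simp add: invertible_op_scaleR)
  next
    case False
    then have "degree (map_poly complex_of_real r) \<noteq> 0"
      by (simp add: degree_map_poly)
    then obtain z where z: "poly (map_poly complex_of_real r) z = 0"
      using fundamental_theorem_of_algebra[of "map_poly complex_of_real r"]
      by (auto simp: constant_degree)
    obtain s where s: "s dvd r" "invertible_op (poly_op s A)" "degree s > 0"
    proof (cases "Im z = 0")
      case True
      define t where "t = Re z"
      have "z = complex_of_real t" using True by (simp add: complex_eq_iff t_def)
      then have root: "poly r t = 0"
        using z by (simp add: poly_map_poly_of_real)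
      then have "invertible_op (poly_op [:- t, 1:] A)"
        using less.prems(2)[of t] of_real_in_spectrum_iff[of t A] by (auto simp: poly_op_linear)
      then show ?thesis
        using that root by (auto simp: poly_eq_0_iff_dvd)
    next
      case False
      then show ?thesis
        using that[OF real_quadratic_factor[OF z] invertible_op_quadratic[OF A]] by simp
    qed
    then obtain k where k: "r = s * k" by auto
    have nz: "s \<noteq> 0" "k \<noteq> 0" using k less.prems(1) by auto
    then have "degree k < degree r"
      using k s(3) by (simp add: degree_mult_eq)
    then have "invertible_op (poly_op k A)"
      using less.prems(2) nz by (intro less.hyps) (auto simp: k)
    then show ?thesis
      unfolding k poly_op_mult using s(2) by (intro invertible_op_compose)
  qed
qed

lemma not_invertible_norm:
  fixes T :: "'h::chilbert_space \<Rightarrow>\<^sub>L 'h"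
  assumes T: "selfadjoint_op T" and nontriv: "(x0::'h) \<noteq> 0"
  shows "\<not> invertible_op ((T o\<^sub>L T) - (norm T)\<^sup>2 *\<^sub>R id_blinfun)"
proof
  define d where "d = norm T"
  define R where "R = (T o\<^sub>L T) - d\<^sup>2 *\<^sub>R id_blinfun"
  assume "invertible_op ((T o\<^sub>L T) - (norm T)\<^sup>2 *\<^sub>R id_blinfun)"
  then obtain B where "B o\<^sub>L R = id_blinfun"
    unfolding invertible_op_def R_def d_def by blast
  then have B: "B (R x) = x" for x
    by (metis blinfun_apply_blinfun_compose blinfun_apply_id_blinfun)
  define K where "K = (norm B)\<^sup>2 + 1"
  have K: "K > 0" by (simp add: K_def add_nonneg_pos)
  have lower: "(norm x)\<^sup>2 \<le> K * (d\<^sup>2 * (d\<^sup>2 * (norm x)\<^sup>2 - (norm (T x))\<^sup>2))" for x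
  proof -
    have "norm (T (T x)) \<le> d * norm (T x)"
      unfolding d_def by (rule norm_blinfun)
    then have TT: "(norm (T (T x)))\<^sup>2 \<le> d\<^sup>2 * (norm (T x))\<^sup>2"
      by (metis norm_ge_zero power_mono power_mult_distrib)
    have "(norm (R x))\<^sup>2 = (norm (T (T x)))\<^sup>2 - 2 * d\<^sup>2 * (norm (T x))\<^sup>2 + d\<^sup>2 * d\<^sup>2 * (norm x)\<^sup>2"
      using selfadjoint_opD(2)[OF T, of "T x" x]
      unfolding R_def power2_norm_eq_inner
      by (simp add: blinfun.bilinear_simps inner_simps inner_commute algebra_simps)
    also have "\<dots> \<le> d\<^sup>2 * (d\<^sup>2 * (norm x)\<^sup>2 - (norm (T x))\<^sup>2)"
      using TT by (simp add: algebra_simps)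
    finally have R: "(norm (R x))\<^sup>2 \<le> d\<^sup>2 * (d\<^sup>2 * (norm x)\<^sup>2 - (norm (T x))\<^sup>2)" .
    have "norm x \<le> norm B * norm (R x)"
      using norm_blinfun[of B "R x"] by (simp add: B)
    then have "(norm x)\<^sup>2 \<le> (norm B)\<^sup>2 * (norm (R x))\<^sup>2"
      by (metis norm_ge_zero power_mono power_mult_distrib)
    also have "\<dots> \<le> K * (norm (R x))\<^sup>2"
      by (simp add: K_def mult_right_mono)
    also have "\<dots> \<le> K * (d\<^sup>2 * (d\<^sup>2 * (norm x)\<^sup>2 - (norm (T x))\<^sup>2))"
      using R K by simp
    finally show ?thesis .
  qed
  have "d \<noteq> 0"
    using lower[of x0] nontriv by auto
  then have d: "d > 0" by (simp add: d_def)
  define e where "e = sqrt (max 0 (d\<^sup>2 - 1 / (K * d\<^sup>2)))"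
  have "norm (T x) \<le> e * norm x" for x
  proof -
    have "(norm (T x))\<^sup>2 \<le> (d\<^sup>2 - 1 / (K * d\<^sup>2)) * (norm x)\<^sup>2"
      using lower[of x] K d by (simp add: field_simps)
    also have "\<dots> \<le> max 0 (d\<^sup>2 - 1 / (K * d\<^sup>2)) * (norm x)\<^sup>2"
      by (intro mult_right_mono) auto
    also have "\<dots> = (e * norm x)\<^sup>2"
      by (simp add: e_def power_mult_distrib)
    finally show ?thesis
      by (rule power2_le_imp_le) (simp add: e_def)
  qed
  then have "d \<le> e"
    unfolding d_def by (intro norm_blinfun_bound) (auto simp: e_def)
  moreover have "e < d"
    unfolding e_def using K d by (intro real_less_lsqrt) auto
  ultimately show False by simp
qed

lemma poly_op_norm_attained:
  fixes A :: "'h::chilbert_space \<Rightarrow>\<^sub>L 'h"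
  assumes A: "selfadjoint_op A" and nontriv: "(x0::'h) \<noteq> 0" and "degree q \<noteq> 0"
  obtains t where "complex_of_real t \<in> spectrum A" "\<bar>poly q t\<bar> = norm (poly_op q A)"
proof -
  define d where "d = norm (poly_op q A)"
  define r where "r = q * q - [:d\<^sup>2:]"
  have "degree (q * q) \<noteq> 0"
    using assms(3) by (cases "q = 0") (auto simp: degree_mult_eq)
  then have "r \<noteq> 0"
    by (auto simp: r_def)
  moreover have "\<not> invertible_op (poly_op r A)"
    using not_invertible_norm[OF poly_op_selfadjoint[OF A] nontriv, of q]
    by (simp add: r_def d_def poly_op_diff poly_op_mult)
  ultimately obtain t where t: "complex_of_real t \<in> spectrum A" "poly r t = 0"
    using invertible_poly_op[OF A] by blast
  then have "(poly q t)\<^sup>2 = d\<^sup>2"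
    by (simp add: r_def power2_eq_square)
  then have "\<bar>poly q t\<bar> = d"
    by (metis abs_norm_cancel d_def power2_eq_iff abs_minus_cancel)
  then show ?thesis
    using that t(1) by (simp add: d_def)
qed

lemma norm_poly_op_le:
  fixes A :: "'h::chilbert_space \<Rightarrow>\<^sub>L 'h"
  assumes A: "selfadjoint_op A" and "c \<ge> 0"
    and le: "\<And>t. complex_of_real t \<in> spectrum A \<Longrightarrow> \<bar>poly q t\<bar> \<le> c"
  shows "norm (poly_op q A) \<le> c"
proof (cases "\<exists>x::'h. x \<noteq> 0")
  case True
  then obtain x0 :: 'h where nontriv: "x0 \<noteq> 0" by blast
  show ?thesis
  proof (cases "degree q = 0")
    case True
    then obtain a where q: "q = [:a:]" by (metis degree_eq_zeroE)
    obtain t where "complex_of_real t \<in> spectrum A"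
      using poly_op_norm_attained[OF A nontriv, of "[:0,1:]"] by auto
    then have "\<bar>a\<bar> \<le> c" using le[of t] q by simp
    moreover have "norm (poly_op q A) \<le> \<bar>a\<bar> * 1"
      unfolding q poly_op_const norm_scaleR by (intro mult_left_mono norm_blinfun_id_le) simp
    ultimately show ?thesis by simp
  next
    case False
    then show ?thesis
      using poly_op_norm_attained[OF A nontriv False] le by metis
  qed
next
  case False
  then have "poly_op q A = 0"
    by (intro blinfun_eqI) auto
  then show ?thesis using assms(2) by simp
qed

lemma spectrum_poly_le:
  assumes A: "selfadjoint_op A" and t: "complex_of_real t \<in> spectrum A"
  shows "\<bar>poly q t\<bar> \<le> norm (poly_op q A)"
proof (rule ccontr)
  assume less: "\<not> ?thesis"
  define T where "T = poly_op q A"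
  have gt: "norm T < \<bar>poly q t\<bar>"
    using less by (simp add: T_def)
  define s where "s = sgn (poly q t)"
  have s: "s * poly q t = \<bar>poly q t\<bar>" "\<bar>s\<bar> = 1" "s \<noteq> 0"
    using gt by (auto simp: s_def sgn_mult_abs mult.commute abs_sgn sgn_if split: if_splits)
  define p where "p = smult s ([:poly q t:] - q)"
  have p: "poly_op p A = s *\<^sub>R (poly q t *\<^sub>R id_blinfun - T)"
    by (simp add: p_def T_def poly_op_smult poly_op_diff)
  have "invertible_op (poly_op p A)"
  proof (rule invertible_opI_coercive)
    show "poly_op p A \<in> bounded_ops"
      using A by (intro poly_op_bounded_ops selfadjoint_opD)
    show "\<bar>poly q t\<bar> - norm T > 0" using gt by simp
    show "(\<bar>poly q t\<bar> - norm T) * (x \<bullet> x) \<le> poly_op p A x \<bullet> x" for x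
    proof -
      have "s * (T x \<bullet> x) \<le> \<bar>s * (T x \<bullet> x)\<bar>" by simp
      also have "\<dots> = \<bar>T x \<bullet> x\<bar>" using s(2) by (simp add: abs_mult)
      also have "\<dots> \<le> norm (T x) * norm x"
        by (rule Cauchy_Schwarz_ineq2)
      also have "\<dots> \<le> norm T * norm x * norm x"
        by (intro mult_right_mono norm_blinfun norm_ge_zero)
      also have "\<dots> = norm T * (x \<bullet> x)"
        by (simp add: power2_eq_square flip: power2_norm_eq_inner)
      finally have "s * (T x \<bullet> x) \<le> norm T * (x \<bullet> x)" .
      then show ?thesis
        unfolding p s(1)[symmetric]
        by (simp add: blinfun.bilinear_simps inner_simps algebra_simps)
    qed
  qed
  moreover have "poly p t = 0" by (simp add: p_def)
  then obtain k where k: "p = [:- t, 1:] * k"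
    by (auto simp: poly_eq_0_iff_dvd)
  have "poly_op [:- t, 1:] A o\<^sub>L poly_op k A = poly_op p A"
    by (simp add: k poly_op_mult del: mult_pCons_left)
  ultimately have "invertible_op (poly_op [:- t, 1:] A)"
    using invertible_op_factor[OF _ _ poly_op_commute] A poly_op_bounded_ops selfadjoint_opD(1)
    by metis
  then show False
    using t by (simp add: of_real_in_spectrum_iff poly_op_linear)
qed

section \<open>Continuous functional calculus\<close>

definition op_within :: "real \<Rightarrow> real \<Rightarrow> ('h::chilbert_space \<Rightarrow>\<^sub>L 'h) \<Rightarrow> bool" where
  "op_within a b A \<longleftrightarrow> selfadjoint_op A \<and> (\<forall>x. a * (x \<bullet> x) \<le> A x \<bullet> x \<and> A x \<bullet> x \<le> b * (x \<bullet> x))"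

definition real_spectrum :: "('h::chilbert_space \<Rightarrow>\<^sub>L 'h) \<Rightarrow> real set" where
  "real_spectrum A = {t. complex_of_real t \<in> spectrum A}"

lemma op_withinD:
  fixes A :: "'h::chilbert_space \<Rightarrow>\<^sub>L 'h"
  assumes "op_within a b A"
  shows "selfadjoint_op A" "A \<in> bounded_ops" "a * (x \<bullet> x) \<le> A x \<bullet> x" "A x \<bullet> x \<le> b * (x \<bullet> x)"
  using assms selfadjoint_opD by (auto simp: op_within_def)

lemma real_spectrum_within:
  fixes A :: "'h::chilbert_space \<Rightarrow>\<^sub>L 'h"
  assumes A: "op_within a b A"
  shows "real_spectrum A \<subseteq> {a..b}"
proof
  fix t assume t: "t \<in> real_spectrum A"
  have not_inv: "\<not> invertible_op (A - t *\<^sub>R id_blinfun)"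
    using t by (simp add: real_spectrum_def of_real_in_spectrum_iff)
  have bo: "A - t *\<^sub>R id_blinfun \<in> bounded_ops" "t *\<^sub>R id_blinfun - A \<in> bounded_ops"
    by (intro bounded_ops_closed_intros op_withinD[OF A])+
  have "a \<le> t"
  proof (rule ccontr)
    assume "\<not> a \<le> t"
    then have "invertible_op (A - t *\<^sub>R id_blinfun)"
      using op_withinD(3)[OF A]
      by (intro invertible_opI_coercive[OF bo(1), of "a - t"])
        (auto simp: blinfun.bilinear_simps inner_simps algebra_simps)
    then show False using not_inv by simp
  qed
  moreover have "t \<le> b"
  proof (rule ccontr)
    assume "\<not> t \<le> b"
    then have "invertible_op (t *\<^sub>R id_blinfun - A)"
      using op_withinD(4)[OF A]
      by (intro invertible_opI_coercive[OF bo(2), of "t - b"])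
        (auto simp: blinfun.bilinear_simps inner_simps algebra_simps)
    then have "invertible_op (((- 1) *\<^sub>R id_blinfun) o\<^sub>L (t *\<^sub>R id_blinfun - A))"
      by (intro invertible_op_compose invertible_op_scaleR) auto
    moreover have "((- 1) *\<^sub>R id_blinfun) o\<^sub>L (t *\<^sub>R id_blinfun - A) = A - t *\<^sub>R id_blinfun"
      by (rule blinfun_eqI) (simp add: blinfun.bilinear_simps)
    ultimately show False using not_inv by simp
  qed
  ultimately show "t \<in> {a..b}" by simp
qed

lemma polynomial_uniform_approximation:
  fixes f :: "real \<Rightarrow> real"
  assumes "continuous_on {a..b} f"
  obtains q where "uniform_limit {a..b} (\<lambda>n. poly (q n)) f sequentially"
proof -
  have "\<exists>q. \<forall>t\<in>{a..b}. \<bar>f t - poly q t\<bar> < 1 / real (Suc n)" for n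
  proof -
    obtain g where g: "real_polynomial_function g" "\<And>t. t \<in> {a..b} \<Longrightarrow> \<bar>f t - g t\<bar> < 1 / real (Suc n)"
      using Stone_Weierstrass_real_polynomial_function[OF compact_Icc assms, of "1 / real (Suc n)"]
      by auto
    obtain c m where g_eq: "g = (\<lambda>t. \<Sum>i\<le>m. c i * t ^ i)"
      using g(1) real_polynomial_function_iff_sum by blast
    have "g t = poly (\<Sum>i\<le>m. monom (c i) i) t" for t
      by (simp add: g_eq poly_sum poly_monom)
    then show ?thesis
      using g(2) by (intro exI[of _ "\<Sum>i\<le>m. monom (c i) i"]) auto
  qed
  then obtain q where q: "\<And>n t. t \<in> {a..b} \<Longrightarrow> \<bar>f t - poly (q n) t\<bar> < 1 / real (Suc n)"
    by metis
  have "uniform_limit {a..b} (\<lambda>n. poly (q n)) f sequentially"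
  proof (rule uniform_limitI)
    fix e :: real assume "e > 0"
    then have "\<forall>\<^sub>F n in sequentially. 1 / real (Suc n) < e"
      using order_tendstoD(2)[OF LIMSEQ_Suc[OF lim_1_over_n]] by auto
    then show "\<forall>\<^sub>F n in sequentially. \<forall>t\<in>{a..b}. dist (poly (q n) t) (f t) < e"
    proof eventually_elim
      case (elim n)
      then show ?case
        using q[of _ n] by (metis dist_real_def abs_minus_commute less_trans)
    qed
  qed
  then show ?thesis by (rule that)
qed

lemma poly_op_norm_diff_le:
  assumes "selfadjoint_op A" "c \<ge> 0"
    "\<And>t. t \<in> real_spectrum A \<Longrightarrow> \<bar>poly p t - poly q t\<bar> \<le> c"
  shows "norm (poly_op p A - poly_op q A) \<le> c"
  using norm_poly_op_le[OF assms(1,2), of "p - q"] assms(3)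
  by (simp add: poly_op_diff real_spectrum_def)

lemma poly_op_Cauchy:
  assumes A: "selfadjoint_op A"
    and q: "uniform_limit (real_spectrum A) (\<lambda>n. poly (q n)) f sequentially"
  shows "Cauchy (\<lambda>n. poly_op (q n) A)"
proof (rule metric_CauchyI)
  fix e :: real assume e: "e > 0"
  then obtain N where N: "\<And>n t. n \<ge> N \<Longrightarrow> t \<in> real_spectrum A \<Longrightarrow> dist (poly (q n) t) (f t) < e / 4"
    using uniform_limitD[OF q, of "e / 4"] by (auto simp: eventually_sequentially)
  have "dist (poly_op (q m) A) (poly_op (q n) A) < e" if "m \<ge> N" "n \<ge> N" for m n
  proof -
    have "norm (poly_op (q m) A - poly_op (q n) A) \<le> e / 2"
    proof (rule poly_op_norm_diff_le[OF A])
      show "\<bar>poly (q m) t - poly (q n) t\<bar> \<le> e / 2" if "t \<in> real_spectrum A" for t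
        using N[OF \<open>m \<ge> N\<close> that] N[OF \<open>n \<ge> N\<close> that]
          unfolding dist_real_def by linarith
    qed (use e in simp)
    then show ?thesis using e by (simp add: dist_norm)
  qed
  then show "\<exists>N. \<forall>m\<ge>N. \<forall>n\<ge>N. dist (poly_op (q m) A) (poly_op (q n) A) < e"
    by blast
qed

lemma poly_op_same_limit:
  assumes A: "selfadjoint_op A"
    and p: "uniform_limit (real_spectrum A) (\<lambda>n. poly (p n)) f sequentially"
    and q: "uniform_limit (real_spectrum A) (\<lambda>n. poly (q n)) f sequentially"
    and B: "(\<lambda>n. poly_op (p n) A) \<longlonglongrightarrow> B"
  shows "(\<lambda>n. poly_op (q n) A) \<longlonglongrightarrow> B"
proof (rule Lim_transform[OF B], rule LIMSEQ_I)
  fix e :: real assume e: "e > 0"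
  obtain N where N: "\<And>n t. n \<ge> N \<Longrightarrow> t \<in> real_spectrum A \<Longrightarrow> dist (poly (p n) t) (f t) < e / 4"
    using uniform_limitD[OF p, of "e / 4"] e by (auto simp: eventually_sequentially)
  obtain N' where N': "\<And>n t. n \<ge> N' \<Longrightarrow> t \<in> real_spectrum A \<Longrightarrow> dist (poly (q n) t) (f t) < e / 4"
    using uniform_limitD[OF q, of "e / 4"] e by (auto simp: eventually_sequentially)
  have "norm (poly_op (q n) A - poly_op (p n) A - 0) < e" if n: "n \<ge> N + N'" for n
  proof -
    have "norm (poly_op (q n) A - poly_op (p n) A) \<le> e / 2"
    proof (rule poly_op_norm_diff_le[OF A])
      show "\<bar>poly (q n) t - poly (p n) t\<bar> \<le> e / 2" if "t \<in> real_spectrum A" for t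
        using N[OF add_leD1[OF n] that] N'[OF add_leD2[OF n] that]
        unfolding dist_real_def by linarith
    qed (use e in simp)
    then show ?thesis using e by simp
  qed
  then show "\<exists>N. \<forall>n\<ge>N. norm (poly_op (q n) A - poly_op (p n) A - 0) < e"
    by blast
qed

lemma cfc_limit:
  assumes A: "op_within a b A" and f: "continuous_on {a..b} f"
    and q: "uniform_limit (real_spectrum A) (\<lambda>n. poly (q n)) f sequentially"
  shows "(\<lambda>n. poly_op (q n) A) \<longlonglongrightarrow> cfc f A"
proof -
  let ?R = "\<lambda>B. \<forall>q. uniform_limit (real_spectrum A) (\<lambda>n. poly (q n)) f sequentially
      \<longrightarrow> (\<lambda>n. poly_op (q n) A) \<longlonglongrightarrow> B"
  note sa = op_withinD(1)[OF A]
  obtain q0 where "uniform_limit {a..b} (\<lambda>n. poly (q0 n)) f sequentially"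
    using polynomial_uniform_approximation[OF f] .
  then have q0: "uniform_limit (real_spectrum A) (\<lambda>n. poly (q0 n)) f sequentially"
    using real_spectrum_within[OF A] by (rule uniform_limit_on_subset)
  obtain B where B: "(\<lambda>n. poly_op (q0 n) A) \<longlonglongrightarrow> B"
    using Cauchy_convergent[OF poly_op_Cauchy[OF sa q0]] convergentD by blast
  have "\<exists>!B. ?R B"
  proof (rule ex1I[of _ B])
    show "?R B"
      using poly_op_same_limit[OF sa q0 _ B] by blast
    show "B' = B" if "?R B'" for B'
      using that q0 B LIMSEQ_unique by blast
  qed
  then have "?R (THE B. ?R B)"
    by (rule theI')
  then show ?thesis
    using q unfolding cfc_def real_spectrum_def by blast
qed

lemma cfc_approximation:
  assumes A: "op_within a b A" and f: "continuous_on {a..b} f"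
  obtains q where "uniform_limit {a..b} (\<lambda>n. poly (q n)) f sequentially"
    and "(\<lambda>n. poly_op (q n) A) \<longlonglongrightarrow> cfc f A"
  using polynomial_uniform_approximation[OF f]
    cfc_limit[OF A f uniform_limit_on_subset[OF _ real_spectrum_within[OF A]]] by metis

lemma cfc_eqI:
  assumes A: "op_within a b A" and f: "continuous_on {a..b} f"
    and "uniform_limit {a..b} (\<lambda>n. poly (q n)) f sequentially"
    and "(\<lambda>n. poly_op (q n) A) \<longlonglongrightarrow> B"
  shows "cfc f A = B"
  using cfc_limit[OF A f uniform_limit_on_subset[OF assms(3) real_spectrum_within[OF A]]] assms(4)
  by (rule LIMSEQ_unique)

lemma cfc_poly:
  assumes A: "op_within a b A" and f: "\<And>t. t \<in> {a..b} \<Longrightarrow> f t = poly q t"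
  shows "cfc f A = poly_op q A"
proof (rule cfc_eqI[OF A])
  show "continuous_on {a..b} f"
    using f by (subst continuous_on_cong[OF refl f]) (auto intro: continuous_intros)
  show "uniform_limit {a..b} (\<lambda>n. poly q) f sequentially"
    using f by (intro uniform_limitI) auto
qed simp

lemma cfc_cong:
  assumes A: "op_within a b A" and f: "continuous_on {a..b} f"
    and eq: "\<And>t. t \<in> {a..b} \<Longrightarrow> f t = g t"
  shows "cfc f A = cfc g A"
proof -
  obtain q where q: "uniform_limit {a..b} (\<lambda>n. poly (q n)) f sequentially"
    "(\<lambda>n. poly_op (q n) A) \<longlonglongrightarrow> cfc f A"
    using cfc_approximation[OF A f] .
  have "continuous_on {a..b} g"
    using f eq continuous_on_cong by metis
  moreover have "uniform_limit {a..b} (\<lambda>n. poly (q n)) g sequentially"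
    using q(1) by (rule uniform_limit_cong'[THEN iffD1, rotated -1]) (simp_all add: eq)
  ultimately show ?thesis
    using cfc_eqI[OF A _ _ q(2), of g] by simp
qed

lemma cfc_add:
  assumes A: "op_within a b A" and f: "continuous_on {a..b} f" and g: "continuous_on {a..b} g"
  shows "cfc (\<lambda>t. f t + g t) A = cfc f A + cfc g A"
proof -
  obtain p where p: "uniform_limit {a..b} (\<lambda>n. poly (p n)) f sequentially"
    "(\<lambda>n. poly_op (p n) A) \<longlonglongrightarrow> cfc f A"
    using cfc_approximation[OF A f] .
  obtain q where q: "uniform_limit {a..b} (\<lambda>n. poly (q n)) g sequentially"
    "(\<lambda>n. poly_op (q n) A) \<longlonglongrightarrow> cfc g A"
    using cfc_approximation[OF A g] .
  show ?thesis
  proof (rule cfc_eqI[OF A])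
    show "uniform_limit {a..b} (\<lambda>n. poly (p n + q n)) (\<lambda>t. f t + g t) sequentially"
      using uniform_limit_add[OF p(1) q(1)] by (simp add: poly_add[abs_def])
    show "(\<lambda>n. poly_op (p n + q n) A) \<longlonglongrightarrow> cfc f A + cfc g A"
      unfolding poly_op_add by (intro tendsto_add p q)
  qed (intro continuous_intros f g)
qed

lemma cfc_mult:
  assumes A: "op_within a b A" and f: "continuous_on {a..b} f" and g: "continuous_on {a..b} g"
  shows "cfc (\<lambda>t. f t * g t) A = cfc f A o\<^sub>L cfc g A"
proof -
  obtain p where p: "uniform_limit {a..b} (\<lambda>n. poly (p n)) f sequentially"
    "(\<lambda>n. poly_op (p n) A) \<longlonglongrightarrow> cfc f A"
    using cfc_approximation[OF A f] .
  obtain q where q: "uniform_limit {a..b} (\<lambda>n. poly (q n)) g sequentially"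
    "(\<lambda>n. poly_op (q n) A) \<longlonglongrightarrow> cfc g A"
    using cfc_approximation[OF A g] .
  have bounded: "bounded (f ` {a..b})" "bounded (g ` {a..b})"
    using f g compact_continuous_image compact_imp_bounded by blast+
  show ?thesis
  proof (rule cfc_eqI[OF A])
    show "uniform_limit {a..b} (\<lambda>n. poly (p n * q n)) (\<lambda>t. f t * g t) sequentially"
      using uniform_lim_mult[OF p(1) q(1) bounded] by (simp add: poly_mult[abs_def])
    show "(\<lambda>n. poly_op (p n * q n) A) \<longlonglongrightarrow> (cfc f A o\<^sub>L cfc g A)"
      unfolding poly_op_mult
      by (intro bounded_bilinear.tendsto[OF bounded_bilinear_blinfun_compose] p q)
  qed (intro continuous_intros f g)
qed

lemma cfc_const: "op_within a b A \<Longrightarrow> cfc (\<lambda>t. c) A = c *\<^sub>R id_blinfun"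
  using cfc_poly[of a b A "\<lambda>t. c" "[:c:]"] by simp

lemma cfc_cmult:
  assumes A: "op_within a b A" and f: "continuous_on {a..b} f"
  shows "cfc (\<lambda>t. c * f t) A = c *\<^sub>R cfc f A"
  using cfc_mult[OF A _ f, of "\<lambda>t. c"] cfc_const[OF A, of c]
  by (auto intro!: blinfun_eqI simp: blinfun.bilinear_simps)

lemma cfc_diff:
  assumes A: "op_within a b A" and f: "continuous_on {a..b} f" and g: "continuous_on {a..b} g"
  shows "cfc (\<lambda>t. f t - g t) A = cfc f A - cfc g A"
  using cfc_add[OF A f, of "\<lambda>t. (-1) * g t"] cfc_cmult[OF A g, of "-1"] g
  by (simp add: continuous_on_minus)

lemma cfc_in_closed_op_algebra:
  assumes A: "op_within a b A" and f: "continuous_on {a..b} f"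
    and M: "closed_op_algebra M" "A \<in> M"
  shows "cfc f A \<in> M"
proof -
  obtain q where "(\<lambda>n. poly_op (q n) A) \<longlonglongrightarrow> cfc f A"
    using cfc_approximation[OF A f] .
  then show ?thesis
    by (rule closed_sequentially[OF closed_op_algebraD(1)[OF M(1)], rotated])
      (rule poly_op_in_closed_op_algebra[OF M])
qed

lemma cfc_selfadjoint:
  assumes A: "op_within a b A" and f: "continuous_on {a..b} f"
  shows "selfadjoint_op (cfc f A)"
proof -
  obtain q where "(\<lambda>n. poly_op (q n) A) \<longlonglongrightarrow> cfc f A"
    using cfc_approximation[OF A f] .
  then have "cfc f A \<in> {A. selfadjoint_op A}"
    by (rule closed_sequentially[OF closed_selfadjoint_op, rotated])
      (use A in \<open>auto intro: poly_op_selfadjoint op_withinD\<close>)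
  then show ?thesis by simp
qed

lemma cfc_norm_le:
  assumes A: "op_within a b A" and f: "continuous_on {a..b} f" and c: "c \<ge> 0"
    and le: "\<And>t. t \<in> {a..b} \<Longrightarrow> \<bar>f t\<bar> \<le> c"
  shows "norm (cfc f A) \<le> c"
proof (rule field_le_epsilon)
  fix e :: real assume e: "e > 0"
  obtain q where q: "uniform_limit {a..b} (\<lambda>n. poly (q n)) f sequentially"
    "(\<lambda>n. poly_op (q n) A) \<longlonglongrightarrow> cfc f A"
    using cfc_approximation[OF A f] .
  have "\<forall>\<^sub>F n in sequentially. norm (poly_op (q n) A) \<le> c + e"
    using uniform_limitD[OF q(1) e]
  proof eventually_elim
    case (elim n)
    show ?case
    proof (rule norm_poly_op_le)
      fix t assume "complex_of_real t \<in> spectrum A"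
      then have t: "t \<in> {a..b}"
        using real_spectrum_within[OF A] by (auto simp: real_spectrum_def)
      show "\<bar>poly (q n) t\<bar> \<le> c + e"
        using elim[rule_format, OF t] le[OF t] by (simp add: dist_real_def)
    qed (use A c e in \<open>auto intro: op_withinD\<close>)
  qed
  then show "norm (cfc f A) \<le> c + e"
    by (intro tendsto_upperbound[OF tendsto_norm[OF q(2)]]) auto
qed

lemma cfc_nonneg:
  fixes A :: "'h::chilbert_space \<Rightarrow>\<^sub>L 'h"
  assumes A: "op_within a b A" and f: "continuous_on {a..b} f"
    and nonneg: "\<And>t. t \<in> {a..b} \<Longrightarrow> 0 \<le> f t"
  obtains W where "W = cfc (\<lambda>t. sqrt (f t)) A" "selfadjoint_op W" "cfc f A = W o\<^sub>L W"
proof -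
  have s: "continuous_on {a..b} (\<lambda>t. sqrt (f t))"
    by (intro continuous_intros f)
  have "cfc f A = cfc (\<lambda>t. sqrt (f t) * sqrt (f t)) A"
    using nonneg by (intro cfc_cong[OF A f]) auto
  also have "\<dots> = cfc (\<lambda>t. sqrt (f t)) A o\<^sub>L cfc (\<lambda>t. sqrt (f t)) A"
    by (rule cfc_mult[OF A s s])
  finally show ?thesis
    using that cfc_selfadjoint[OF A s] by blast
qed

lemma cfc_within:
  fixes A :: "'h::chilbert_space \<Rightarrow>\<^sub>L 'h"
  assumes A: "op_within a b A" and f: "continuous_on {a..b} f" and im: "f ` {a..b} \<subseteq> {c..d}"
  shows "op_within c d (cfc f A)"
proof -
  have pos: "0 \<le> cfc g A x \<bullet> x"
    if g: "continuous_on {a..b} g" "\<And>t. t \<in> {a..b} \<Longrightarrow> 0 \<le> g t" for g x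
  proof -
    obtain W where W: "selfadjoint_op W" "cfc g A = W o\<^sub>L W"
      using cfc_nonneg[OF A g] by blast
    then have "cfc g A x \<bullet> x = W x \<bullet> W x"
      using selfadjoint_opD(2) by simp
    then show ?thesis by simp
  qed
  have "0 \<le> cfc (\<lambda>t. f t - c) A x \<bullet> x" "0 \<le> cfc (\<lambda>t. d - f t) A x \<bullet> x" for x
    using im by (auto intro!: pos continuous_intros f)
  then show ?thesis
    using cfc_diff[OF A f, of "\<lambda>t. c"] cfc_diff[OF A _ f, of "\<lambda>t. d"] cfc_selfadjoint[OF A f]
    by (simp add: op_within_def cfc_const[OF A] blinfun.bilinear_simps inner_simps)
qed

lemma poly_op_cfc:
  assumes A: "op_within a b A" and f: "continuous_on {a..b} f"
  shows "poly_op q (cfc f A) = cfc (\<lambda>t. poly q (f t)) A"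
proof (induction q)
  case 0
  then show ?case using cfc_const[OF A, of 0] by simp
next
  case (pCons c q)
  have q: "continuous_on {a..b} (\<lambda>t. poly q (f t))"
    by (intro continuous_intros f)
  have fq: "continuous_on {a..b} (\<lambda>t. f t * poly q (f t))"
    by (intro continuous_intros f)
  show ?case
    using cfc_add[OF A continuous_on_const fq, of c] cfc_mult[OF A f q] cfc_const[OF A, of c]
    by (simp add: poly_op_pCons pCons.IH)
qed

theorem cfc_compose:
  assumes A: "op_within a b A" and g: "continuous_on {a..b} g" and im: "g ` {a..b} \<subseteq> {c..d}"
    and f: "continuous_on {c..d} f"
  shows "cfc f (cfc g A) = cfc (\<lambda>t. f (g t)) A"
proof -
  have fg: "continuous_on {a..b} (\<lambda>t. f (g t))"
    using continuous_on_compose2[OF f g im] .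
  obtain q where q: "uniform_limit {c..d} (\<lambda>n. poly (q n)) f sequentially"
    "(\<lambda>n. poly_op (q n) (cfc g A)) \<longlonglongrightarrow> cfc f (cfc g A)"
    using cfc_approximation[OF cfc_within[OF A g im] f] .
  have "(\<lambda>n. poly_op (q n) (cfc g A)) \<longlonglongrightarrow> cfc (\<lambda>t. f (g t)) A"
  proof (rule tendstoI)
    fix e :: real assume e: "e > 0"
    then have "\<forall>\<^sub>F n in sequentially. \<forall>s\<in>{c..d}. dist (poly (q n) s) (f s) < e / 2"
      by (intro uniform_limitD[OF q(1)]) simp
    then show "\<forall>\<^sub>F n in sequentially. dist (poly_op (q n) (cfc g A)) (cfc (\<lambda>t. f (g t)) A) < e"
    proof eventually_elim
      case (elim n)
      have qg: "continuous_on {a..b} (\<lambda>t. poly (q n) (g t))"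
        by (intro continuous_intros g)
      have "norm (cfc (\<lambda>t. poly (q n) (g t) - f (g t)) A) \<le> e / 2"
      proof (rule cfc_norm_le[OF A])
        show "\<bar>poly (q n) (g t) - f (g t)\<bar> \<le> e / 2" if "t \<in> {a..b}" for t
          using elim im that by (force simp: dist_real_def)
      qed (use e qg fg in \<open>auto intro: continuous_on_diff\<close>)
      then show ?case
        using e by (simp add: dist_norm poly_op_cfc[OF A g] cfc_diff[OF A qg fg])
    qed
  qed
  then show ?thesis
    using q(2) LIMSEQ_unique by blast
qed

lemma cfc_eq_0D:
  assumes A: "op_within a b A" and f: "continuous_on {a..b} f"
    and "cfc f A = 0" and t: "t \<in> real_spectrum A"
  shows "f t = 0"
proof -
  obtain q where q: "uniform_limit {a..b} (\<lambda>n. poly (q n)) f sequentially"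
    "(\<lambda>n. poly_op (q n) A) \<longlonglongrightarrow> cfc f A"
    using cfc_approximation[OF A f] .
  have "t \<in> {a..b}" using real_spectrum_within[OF A] t by blast
  then have 1: "(\<lambda>n. poly (q n) t) \<longlonglongrightarrow> f t"
    by (rule tendsto_uniform_limitI[OF q(1)])
  have "(\<lambda>n. norm (poly_op (q n) A)) \<longlonglongrightarrow> 0"
    using tendsto_norm[OF q(2)] assms(3) by simp
  then have "(\<lambda>n. poly (q n) t) \<longlonglongrightarrow> 0"
    by (rule Lim_null_comparison[rotated])
      (use t spectrum_poly_le[OF op_withinD(1)[OF A]] in \<open>auto simp: real_spectrum_def\<close>)
  with 1 show ?thesis
    by (rule LIMSEQ_unique)
qed

lemma eq_scaleR_id_of_real_spectrum:
  assumes A: "selfadjoint_op A" and "real_spectrum A \<subseteq> {c}"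
  shows "A = c *\<^sub>R id_blinfun"
proof -
  have "norm (poly_op [:- c, 1:] A) \<le> 0"
    using assms by (intro norm_poly_op_le) (auto simp: real_spectrum_def)
  then show ?thesis
    by (simp add: poly_op_linear)
qed

lemma cfc_scaleR_id:
  "cfc f (c *\<^sub>R id_blinfun :: 'h::chilbert_space \<Rightarrow>\<^sub>L 'h) = f c *\<^sub>R id_blinfun"
proof -
  define A :: "'h \<Rightarrow>\<^sub>L 'h" where "A = c *\<^sub>R id_blinfun"
  have A: "op_within c c A"
    by (auto simp: A_def op_within_def blinfun.bilinear_simps
        intro!: selfadjoint_opI bounded_ops_closed_intros)
  have "cfc f A = poly_op [:f c:] A"
    by (rule cfc_poly[OF A]) auto
  then show ?thesis by (simp add: A_def)
qed

section \<open>The trace and the p-norm\<close>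

lemma closed_op_algebra_commutant: "closed_op_algebra (commutant N)"
  for N :: "('h::chilbert_space \<Rightarrow>\<^sub>L 'h) set"
proof -
  have "closed {T :: 'h \<Rightarrow>\<^sub>L 'h. T o\<^sub>L S = S o\<^sub>L T}" for S
    by (intro closed_Collect_eq continuous_intros
        bounded_bilinear.continuous_on[OF bounded_bilinear_blinfun_compose])
  then have "closed (bounded_ops \<inter> (\<Inter>S\<in>N. {T. T o\<^sub>L S = S o\<^sub>L T}))"
    by (intro closed_Int closed_INT ballI closed_op_algebraD(1)[OF closed_op_algebra_bounded_ops])
  moreover have "commutant N = bounded_ops \<inter> (\<Inter>S\<in>N. {T. T o\<^sub>L S = S o\<^sub>L T})"
    by (auto simp: commutant_def)
  moreover have "id_blinfun \<in> commutant N"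
    by (auto simp: commutant_def bounded_ops_closed_intros intro!: blinfun_eqI)
  moreover have "S + T \<in> commutant N" "S o\<^sub>L T \<in> commutant N" "r *\<^sub>R S \<in> commutant N"
    if ST: "S \<in> commutant N" "T \<in> commutant N" for S T r
  proof -
    have "S (A x) = A (S x)" "T (A x) = A (T x)" if "A \<in> N" for A x
      using ST that unfolding commutant_def
      by (metis (mono_tags, lifting) blinfun_apply_blinfun_compose mem_Collect_eq)+
    then show "S + T \<in> commutant N" "S o\<^sub>L T \<in> commutant N" "r *\<^sub>R S \<in> commutant N"
      using ST by (auto simp: commutant_def bounded_ops_closed_intros blinfun.bilinear_simps
          intro!: blinfun_eqI)
  qed
  ultimately show ?thesis
    by (simp add: closed_op_algebra_def)
qed

lemma closed_op_algebra_von_neumann: "von_neumann_algebra M \<Longrightarrow> closed_op_algebra M"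
  using closed_op_algebra_commutant unfolding von_neumann_algebra_def by metis

lemma tracial_state_add:
  "tracial_state M \<tau> \<Longrightarrow> S \<in> M \<Longrightarrow> T \<in> M \<Longrightarrow> \<tau> (S + T) = \<tau> S + \<tau> T"
  unfolding tracial_state_def by blast

lemma tracial_state_scaleR:
  assumes "tracial_state M \<tau>" "T \<in> M"
  shows "\<tau> (r *\<^sub>R T) = complex_of_real r * \<tau> T"
proof -
  have "r *\<^sub>R T = scalar_op (complex_of_real r) o\<^sub>L T"
    by (rule blinfun_eqI) (simp add: scalar_op_of_real blinfun.bilinear_simps)
  then show ?thesis
    using assms unfolding tracial_state_def by metis
qed

lemma tracial_state_scaleR_id:
  assumes "tracial_state M \<tau>" "id_blinfun \<in> M"
  shows "\<tau> (r *\<^sub>R id_blinfun) = complex_of_real r"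
  using tracial_state_scaleR[OF assms, of r] assms(1) by (simp add: tracial_state_def)

lemma tracial_state_cfc_nonneg:
  assumes \<tau>: "tracial_state M \<tau>" and M: "closed_op_algebra M" "A \<in> M"
    and A: "op_within a b A" and f: "continuous_on {a..b} f" and "\<And>t. t \<in> {a..b} \<Longrightarrow> 0 \<le> f t"
  shows "\<tau> (cfc f A) \<in> \<real>\<^sub>\<ge>\<^sub>0"
proof -
  obtain W where W: "W = cfc (\<lambda>t. sqrt (f t)) A" "selfadjoint_op W" "cfc f A = W o\<^sub>L W"
    using cfc_nonneg[OF A f assms(6)] by blast
  have "W \<in> M"
    unfolding W(1) by (intro cfc_in_closed_op_algebra[OF A _ M] continuous_intros f)
  then have "\<tau> (adj W o\<^sub>L W) \<in> \<real>\<^sub>\<ge>\<^sub>0"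
    using \<tau> unfolding tracial_state_def by blast
  then show ?thesis
    by (simp add: W(3) selfadjoint_opD(3)[OF W(2)])
qed

lemma tracial_state_cfc_eq_0D:
  assumes \<tau>: "tracial_state M \<tau>" "faithful_on M \<tau>" and M: "closed_op_algebra M" "A \<in> M"
    and A: "op_within a b A" and f: "continuous_on {a..b} f" and "\<And>t. t \<in> {a..b} \<Longrightarrow> 0 \<le> f t"
    and "\<tau> (cfc f A) = 0" and t: "t \<in> real_spectrum A"
  shows "f t = 0"
proof -
  obtain W where W: "W = cfc (\<lambda>t. sqrt (f t)) A" "selfadjoint_op W" "cfc f A = W o\<^sub>L W"
    using cfc_nonneg[OF A f assms(7)] by blast
  have "W \<in> M"
    unfolding W(1) by (intro cfc_in_closed_op_algebra[OF A _ M] continuous_intros f)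
  moreover have "\<tau> (adj W o\<^sub>L W) = 0"
    using assms(8) by (simp add: W(3) selfadjoint_opD(3)[OF W(2)])
  ultimately have "W = 0"
    using \<tau>(2) unfolding faithful_on_def by blast
  then have "cfc f A = 0"
    by (simp add: W(3))
  then show ?thesis
    by (rule cfc_eq_0D[OF A f _ t])
qed

lemma continuous_on_powr_pos_exponent: "0 < s \<Longrightarrow> continuous_on {0..b} (\<lambda>t::real. t powr s)"
  by (intro continuous_on_powr' continuous_intros) auto

lemma p_norm_selfadjoint:
  assumes p: "0 < p" and A: "selfadjoint_op A" and X: "op_within 0 1 (A o\<^sub>L A)"
  shows "p_norm \<tau> p A = Re (\<tau> (cfc (\<lambda>t. t powr (p / 2)) (A o\<^sub>L A))) powr (1 / p)"
proof -
  have "cfc (\<lambda>t. t powr p) (abs_op A) = cfc (\<lambda>t. sqrt t powr p) (A o\<^sub>L A)"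
    unfolding abs_op_def selfadjoint_opD(3)[OF A]
    by (rule cfc_compose[OF X, of sqrt 0 1])
      (auto intro!: continuous_intros continuous_on_powr_pos_exponent p)
  also have "\<dots> = cfc (\<lambda>t. t powr (p / 2)) (A o\<^sub>L A)"
  proof (rule cfc_cong[OF X])
    show "continuous_on {0..1} (\<lambda>t. sqrt t powr p)"
      using p by (intro continuous_on_powr' continuous_intros) auto
    show "sqrt t powr p = t powr (p / 2)" if "t \<in> {0..1}" for t
      using that by (simp add: powr_powr flip: powr_half_sqrt)
  qed
  finally show ?thesis
    by (simp add: p_norm_def)
qed

section \<open>Convexity\<close>

lemma powr_sum_extremal_at_half:
  fixes s :: real
  assumes "0 < s" "s \<noteq> 1"
  defines "\<phi> \<equiv> \<lambda>t. t powr s + (1 - t) powr s - 2 * (1 / 2) powr s"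
  obtains \<epsilon> :: real where "\<And>t. t \<in> {0..1} \<Longrightarrow> t \<noteq> 1 / 2 \<Longrightarrow> 0 < \<epsilon> * \<phi> t"
proof -
  define \<epsilon> :: real where "\<epsilon> = (if s > 1 then 1 else - 1)"
  have cont: "continuous_on {1/2..t} (\<lambda>x. \<epsilon> * \<phi> x)" if "t \<le> 1" for t
    unfolding \<phi>_def using that assms by (intro continuous_intros continuous_on_powr') auto
  have right: "0 < \<epsilon> * \<phi> t" if t: "1 / 2 < t" "t \<le> 1" for t
  proof -
    have "\<epsilon> * \<phi> (1 / 2) < \<epsilon> * \<phi> t"
    proof (rule DERIV_pos_imp_increasing_open[OF t(1) _ cont[OF t(2)]])
      fix x assume x: "1 / 2 < x" "x < t"
      have "((\<lambda>x. \<epsilon> * \<phi> x) has_real_derivative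
          \<epsilon> * (s * x powr (s - 1) - s * (1 - x) powr (s - 1))) (at x)"
        unfolding \<phi>_def using x t by (auto intro!: derivative_eq_intros)
      moreover have "0 < \<epsilon> * (x powr (s - 1) - (1 - x) powr (s - 1))"
      proof (cases "s > 1")
        case True
        then have "(1 - x) powr (s - 1) < x powr (s - 1)"
          using x t by (intro powr_less_mono2) auto
        then show ?thesis using True by (simp add: \<epsilon>_def)
      next
        case False
        then have "x powr (s - 1) < (1 - x) powr (s - 1)"
          using x t assms by (intro powr_less_mono2_neg) auto
        then show ?thesis using False by (simp add: \<epsilon>_def)
      qed
      then have "0 < s * (\<epsilon> * (x powr (s - 1) - (1 - x) powr (s - 1)))"
        using assms by simp
      then have "0 < \<epsilon> * (s * x powr (s - 1) - s * (1 - x) powr (s - 1))"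
        by (simp add: algebra_simps)
      ultimately show "\<exists>y. ((\<lambda>x. \<epsilon> * \<phi> x) has_real_derivative y) (at x) \<and> 0 < y"
        by blast
    qed
    then show ?thesis by (simp add: \<phi>_def)
  qed
  have "0 < \<epsilon> * \<phi> t" if "t \<in> {0..1}" "t \<noteq> 1 / 2" for t
  proof (cases "1 / 2 < t")
    case True
    then show ?thesis using right that by simp
  next
    case False
    then have "0 < \<epsilon> * \<phi> (1 - t)"
      using that by (intro right) auto
    then show ?thesis by (simp add: \<phi>_def add.commute)
  qed
  then show ?thesis by (rule that)
qed

lemma op_eq_half_of_trace_powr:
  assumes \<tau>: "tracial_state M \<tau>" "faithful_on M \<tau>" and M: "closed_op_algebra M" "X \<in> M"
    and X: "op_within 0 1 X" and s: "0 < s" "s \<noteq> 1"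
    and eq: "\<tau> (cfc (\<lambda>t. t powr s) X) = complex_of_real ((1 / 2) powr s)"
      "\<tau> (cfc (\<lambda>t. t powr s) (id_blinfun - X)) = complex_of_real ((1 / 2) powr s)"
  shows "X = (1 / 2) *\<^sub>R id_blinfun"
proof -
  define c where "c = 2 * (1 / 2) powr s"
  obtain \<epsilon> :: real where pos:
    "\<And>t. t \<in> {0..1} \<Longrightarrow> t \<noteq> 1 / 2 \<Longrightarrow> 0 < \<epsilon> * (t powr s + (1 - t) powr s - c)"
    using powr_sum_extremal_at_half[OF s] unfolding c_def by blast
  define f where "f t = t powr s + (1 - t) powr s" for t :: real
  have cont1: "continuous_on {0..1::real} (\<lambda>t. t powr s)"
    by (rule continuous_on_powr_pos_exponent[OF s(1)])
  have cont2: "continuous_on {0..1::real} (\<lambda>t. (1 - t) powr s)"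
    using s by (intro continuous_on_powr' continuous_intros) auto
  have cont: "continuous_on {0..1} f"
    unfolding f_def by (intro continuous_on_add cont1 cont2)
  have cont_f: "continuous_on {0..1} (\<lambda>t. \<epsilon> * (f t - c))"
    by (intro continuous_intros cont)
  have "cfc (\<lambda>t. 1 - t) X = poly_op [:1, -1:] X"
    by (rule cfc_poly[OF X]) simp
  also have "\<dots> = id_blinfun - X"
    by (rule blinfun_eqI) (simp add: poly_op_pCons blinfun.bilinear_simps)
  finally have refl: "cfc (\<lambda>t. t powr s) (id_blinfun - X) = cfc (\<lambda>t. (1 - t) powr s) X"
    using cfc_compose[OF X continuous_on_diff[OF continuous_on_const continuous_on_id] _ cont1, of 1]
    by auto
  have "cfc (\<lambda>t. \<epsilon> * (f t - c)) X = \<epsilon> *\<^sub>R (cfc (\<lambda>t. t powr s) X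
      + cfc (\<lambda>t. t powr s) (id_blinfun - X) + (- c) *\<^sub>R id_blinfun)"
    unfolding refl f_def using cont[unfolded f_def]
    by (simp add: cfc_cmult[OF X] cfc_diff[OF X] cfc_add[OF X cont1 cont2] cfc_const[OF X]
        continuous_on_diff)
  also have "\<tau> \<dots> = 0"
  proof -
    have in_M: "cfc (\<lambda>t. t powr s) X \<in> M" "cfc (\<lambda>t. t powr s) (id_blinfun - X) \<in> M"
      "id_blinfun \<in> M"
      unfolding refl using M
      by (auto intro: cfc_in_closed_op_algebra[OF X] cont1 cont2 closed_op_algebraD)
    have tau_id: "\<tau> id_blinfun = 1"
      using \<tau>(1) by (simp add: tracial_state_def)
    show ?thesis
      using in_M M(1)
      by (simp add: tracial_state_scaleR[OF \<tau>(1)] tracial_state_add[OF \<tau>(1)]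
          tracial_state_scaleR_id[OF \<tau>(1)] tau_id closed_op_algebraD eq c_def
          flip: scaleR_minus_left)
  qed
  finally have zero: "\<tau> (cfc (\<lambda>t. \<epsilon> * (f t - c)) X) = 0" .
  have "0 \<le> \<epsilon> * (f t - c)" if "t \<in> {0..1}" for t
  proof (cases "t = 1 / 2")
    case True
    show ?thesis unfolding True by (simp add: f_def c_def)
  qed (use pos that in \<open>auto simp: f_def intro: less_imp_le\<close>)
  then have "\<epsilon> * (f t - c) = 0" if "t \<in> real_spectrum X" for t
    using tracial_state_cfc_eq_0D[OF \<tau> M X cont_f _ zero that] by blast
  then have "real_spectrum X \<subseteq> {1 / 2}"
    using pos real_spectrum_within[OF X] by (force simp: f_def)
  then show ?thesis
    by (intro eq_scaleR_id_of_real_spectrum op_withinD[OF X])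
qed

section \<open>Pairs of projections\<close>

lemma is_projectionD:
  assumes "is_projection P"
  shows "selfadjoint_op P" "P (P x) = P x"
proof -
  show "selfadjoint_op P"
    using assms adjoint_pair_adj unfolding is_projection_def selfadjoint_op_def by metis
  show "P (P x) = P x"
    using assms unfolding is_projection_def by (metis blinfun_apply_blinfun_compose)
qed

lemma selfadjoint_op_intros:
  "selfadjoint_op id_blinfun"
  "selfadjoint_op A \<Longrightarrow> selfadjoint_op B \<Longrightarrow> selfadjoint_op (A - B)"
  by (auto simp: selfadjoint_op_def adjoint_pair_def bounded_ops_closed_intros
      blinfun.bilinear_simps inner_simps)

lemma projection_pair_squares:
  assumes P: "is_projection P" and Q: "is_projection Q"
  shows "((id_blinfun - P) - Q) o\<^sub>L ((id_blinfun - P) - Q) = id_blinfun - ((P - Q) o\<^sub>L (P - Q))"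
  by (rule blinfun_eqI)
    (simp add: blinfun.bilinear_simps is_projectionD(2)[OF P] is_projectionD(2)[OF Q])

lemma projection_diff_square_within:
  assumes P: "is_projection P" and Q: "is_projection Q"
  shows "op_within 0 1 ((P - Q) o\<^sub>L (P - Q))"
proof -
  define D where "D = P - Q"
  define E where "E = (id_blinfun - P) - Q"
  have D: "selfadjoint_op D" and E: "selfadjoint_op E"
    unfolding D_def E_def by (intro selfadjoint_op_intros is_projectionD P Q)+
  have "(E o\<^sub>L E) x = x - (D o\<^sub>L D) x" for x
    using projection_pair_squares[OF P Q] by (simp add: D_def E_def blinfun.bilinear_simps)
  then have "(D o\<^sub>L D) x \<bullet> x \<le> x \<bullet> x" for x
  proof -
    have "x \<bullet> x - (D o\<^sub>L D) x \<bullet> x = E x \<bullet> E x"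
      using \<open>(E o\<^sub>L E) x = x - (D o\<^sub>L D) x\<close> selfadjoint_opD(2)[OF E, of "E x" x]
      by (simp add: inner_diff_left)
    then show ?thesis
      using inner_ge_zero[of "E x"] by linarith
  qed
  moreover have "0 \<le> (D o\<^sub>L D) x \<bullet> x" for x
    using selfadjoint_opD(2)[OF D, of "D x" x] by simp
  moreover have "selfadjoint_op (D o\<^sub>L D)"
    by (intro selfadjoint_opI bounded_ops_closed_intros selfadjoint_opD(1)[OF D])
      (simp add: selfadjoint_opD(2)[OF D])
  ultimately show ?thesis
    unfolding op_within_def D_def by simp
qed

lemma op_within_complement:
  assumes "op_within 0 1 X"
  shows "op_within 0 1 (id_blinfun - X)"
  using assms selfadjoint_op_intros
  by (auto simp: op_within_def blinfun.bilinear_simps inner_simps)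

lemma partial_isometry_of_projection_pair:
  fixes P Q :: "'h::chilbert_space \<Rightarrow>\<^sub>L 'h"
  assumes P: "is_projection P" and Q: "is_projection Q"
    and half: "(P - Q) o\<^sub>L (P - Q) = (1 / 2) *\<^sub>R id_blinfun"
  defines "U \<equiv> 2 *\<^sub>R (Q o\<^sub>L P) - P"
  shows "partial_isometry U" "adj U o\<^sub>L U = P" "U o\<^sub>L adj U = id_blinfun - P"
    "Q = (1 / 2) *\<^sub>R (id_blinfun + U + adj U)"
proof -
  note saP = selfadjoint_opD[OF is_projectionD(1)[OF P]]
  note saQ = selfadjoint_opD[OF is_projectionD(1)[OF Q]]
  note proj [simp] = is_projectionD(2)[OF P] is_projectionD(2)[OF Q]
  have "((P - Q) o\<^sub>L (P - Q)) x = (1 / 2) *\<^sub>R x" for x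
    by (simp add: half blinfun.bilinear_simps)
  then have rel: "P x - P (Q x) - Q (P x) + Q x = (1 / 2) *\<^sub>R x" for x
    by (simp add: blinfun.bilinear_simps algebra_simps)
  have halve: "c = (1 / 2) *\<^sub>R a" if "a = c + (1 / 2) *\<^sub>R a" for a c :: 'h
  proof -
    have "c = (1 - 1 / 2) *\<^sub>R a"
      unfolding scaleR_left_diff_distrib scaleR_one eq_diff_eq by (rule that[symmetric])
    then show ?thesis by simp
  qed
  have half_add_half [simp]: "(1 / 2) *\<^sub>R a + (1 / 2) *\<^sub>R a = a" for a :: 'h
    by (simp flip: scaleR_left_distrib)
  have PQP [simp]: "P (Q (P x)) = (1 / 2) *\<^sub>R P x" for x
    using arg_cong[OF rel[of "P x"], of P]
    by - (rule halve, simp add: blinfun.bilinear_simps algebra_simps)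
  have QPQ [simp]: "Q (P (Q x)) = (1 / 2) *\<^sub>R Q x" for x
    using arg_cong[OF rel[of "Q x"], of Q]
    by - (rule halve, simp add: blinfun.bilinear_simps algebra_simps)
  have double: "(P x - P (Q x) - Q (P x) + Q x) + (P x - P (Q x) - Q (P x) + Q x) = x" for x
    unfolding rel by (rule half_add_half)
  define V where "V = 2 *\<^sub>R (P o\<^sub>L Q) - P"
  have U: "U \<in> bounded_ops"
    unfolding U_def by (intro bounded_ops_closed_intros saP saQ)
  have "adjoint_pair U V"
    by (simp add: adjoint_pair_def U_def V_def blinfun.bilinear_simps inner_simps saP(2) saQ(2))
  then have adj: "adj U = V"
    by (rule adj_eqI[OF U])
  show VU: "adj U o\<^sub>L U = P"
    unfolding adj
    by (rule blinfun_eqI) (simp add: U_def V_def blinfun.bilinear_simps diff_eq_eq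
        scaleR_right_diff_distrib scaleR_2)
  show "U o\<^sub>L adj U = id_blinfun - P"
    unfolding adj
  proof (rule blinfun_eqI)
    fix x
    have "(U o\<^sub>L V) x =
        (P x - P (Q x) - Q (P x) + Q x) + (P x - P (Q x) - Q (P x) + Q x) - P x"
      by (simp add: U_def V_def blinfun.bilinear_simps scaleR_right_diff_distrib scaleR_2)
    then show "(U o\<^sub>L V) x = (id_blinfun - P) x"
      unfolding double by (simp add: blinfun.diff_left)
  qed
  show "Q = (1 / 2) *\<^sub>R (id_blinfun + U + adj U)"
    unfolding adj
  proof (rule blinfun_eqI)
    fix x
    have "Q x + Q x = (P x - P (Q x) - Q (P x) + Q x) + (P x - P (Q x) - Q (P x) + Q x) + U x + V x"
      by (simp add: U_def V_def blinfun.bilinear_simps scaleR_2)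
    then have "(id_blinfun + U + V) x = Q x + Q x"
      unfolding double by (simp add: blinfun.add_left)
    then show "Q x = ((1 / 2) *\<^sub>R (id_blinfun + U + V)) x"
      by (simp only: blinfun.scaleR_left scaleR_half_double)
  qed
  show "partial_isometry U"
    unfolding partial_isometry_def
  proof (intro conjI allI impI U)
    fix x assume "\<forall>y. U y = 0 \<longrightarrow> cinner x y = 0"
    moreover have "U (x - P x) = 0"
      by (simp add: U_def blinfun.bilinear_simps)
    ultimately have "Re (cinner x (x - P x)) = 0"
      by simp
    then have "x \<bullet> (x - P x) = 0"
      by (simp add: Re_cinner)
    then have "(x - P x) \<bullet> (x - P x) = 0"
      using saP(2)[of x "x - P x"] by (simp add: blinfun.bilinear_simps inner_diff_left)
    then have "P x = x" by simp
    have "(norm (U x))\<^sup>2 = x \<bullet> adj U (U x)"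
      by (simp add: power2_norm_eq_inner inner_adj[OF U])
    also have "adj U (U x) = x"
      using VU \<open>P x = x\<close> by (metis blinfun_apply_blinfun_compose)
    finally show "norm (U x) = norm x"
      by (simp add: power2_norm_eq_inner[symmetric])
  qed
qed

lemma projection_diff_square_of_partial_isometry:
  assumes P: "is_projection P" and U: "U \<in> bounded_ops"
    and "adj U o\<^sub>L U = P" "U o\<^sub>L adj U = id_blinfun - P"
    and Q: "Q = (1 / 2) *\<^sub>R (id_blinfun + U + adj U)"
  shows "(P - Q) o\<^sub>L (P - Q) = (1 / 2) *\<^sub>R id_blinfun"
proof -
  note saP = selfadjoint_opD[OF is_projectionD(1)[OF P]]
  note proj [simp] = is_projectionD(2)[OF P]
  define V where "V = adj U"
  have VU [simp]: "V (U x) = P x" and UV [simp]: "U (V x) = x - P x" for x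
    using arg_cong[OF assms(3), of "\<lambda>T. T x"] arg_cong[OF assms(4), of "\<lambda>T. T x"]
    by (simp_all add: V_def blinfun.bilinear_simps)
  have adj: "U x \<bullet> y = x \<bullet> V y" for x y
    using inner_adj[OF U] by (simp add: V_def)
  have UP [simp]: "U (P x) = U x" for x
  proof -
    have "U (x - P x) \<bullet> U (x - P x) = (x - P x) \<bullet> V (U (x - P x))"
      by (rule adj)
    also have "\<dots> = 0"
      unfolding VU by (simp add: blinfun.diff_right)
    finally have "U (x - P x) \<bullet> U (x - P x) = 0" .
    then show ?thesis by (simp add: blinfun.diff_right)
  qed
  have PU [simp]: "P (U x) = 0" for x
    using UV[of "U x"] by simp
  have VP [simp]: "V (P x) = 0" for x
  proof -
    have "V (P x) \<bullet> V (P x) = U (V (P x)) \<bullet> P x"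
      by (rule adj[symmetric])
    also have "\<dots> = 0" by simp
    finally show ?thesis by simp
  qed
  have PV [simp]: "P (V x) = V x" for x
    using VU[of "V x"] by (simp add: blinfun.diff_right)
  have UU [simp]: "U (U x) = 0" for x
    using UP[of "U x"] unfolding PU by (simp add: blinfun.zero_right)
  have VV [simp]: "V (V x) = 0" for x
    using VP[of "V x"] unfolding PV .
  define D where "D = P + P - id_blinfun - U - V"
  have DD: "D (D x) = x + x" for x
    by (simp add: D_def blinfun.bilinear_simps)
  have "P - Q = (1 / 2) *\<^sub>R (P + P) - (1 / 2) *\<^sub>R (id_blinfun + U + V)"
    by (simp only: Q V_def scaleR_half_double)
  also have "\<dots> = (1 / 2) *\<^sub>R D"
    by (simp only: D_def scaleR_right_diff_distrib[symmetric] diff_diff_eq add.assoc)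
  finally have "(P - Q) x = (1 / 2) *\<^sub>R D x" for x
    by (simp only: blinfun.scaleR_left)
  then show ?thesis
    by (intro blinfun_eqI) (simp only: blinfun_apply_blinfun_compose blinfun.scaleR_left
        blinfun.scaleR_right DD scaleR_half_double blinfun_apply_id_blinfun)
qed

lemma powr_inverse_eq_sqrt_half_iff:
  assumes "0 < p" "0 \<le> a"
  shows "a powr (1 / p) = 1 / sqrt 2 \<longleftrightarrow> a = (1 / 2) powr (p / 2)"
proof -
  have sqrt: "1 / sqrt 2 = (1 / 2) powr (1 / 2)"
    by (simp add: powr_half_sqrt real_sqrt_divide)
  show ?thesis
  proof
    assume "a powr (1 / p) = 1 / sqrt 2"
    then have "(a powr (1 / p)) powr p = ((1 / 2) powr (1 / 2)) powr p"
      by (simp only: sqrt)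
    then show "a = (1 / 2) powr (p / 2)"
      using assms by (simp add: powr_powr)
  next
    assume "a = (1 / 2) powr (p / 2)"
    then show "a powr (1 / p) = 1 / sqrt 2"
      unfolding sqrt using assms by (simp add: powr_powr)
  qed
qed

theorem lemma3p1:
  fixes M :: "('h::chilbert_space \<Rightarrow>\<^sub>L 'h) set"
    and \<tau> :: "('h \<Rightarrow>\<^sub>L 'h) \<Rightarrow> complex"
    and p :: real
    and P Q :: "'h \<Rightarrow>\<^sub>L 'h"
  assumes "0 < p" and "p \<noteq> 2"
    and "finite_factor M" and "fn_tracial_state M \<tau>"
    and "P \<in> projections_of_trace M \<tau> (1 / 2)"
    and "Q \<in> projections_of_trace M \<tau> (1 / 2)"
  shows "(p_norm \<tau> p (P - Q) = p_norm \<tau> p ((id_blinfun - P) - Q) \<and>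
          p_norm \<tau> p ((id_blinfun - P) - Q) = 1 / sqrt 2) \<longleftrightarrow>
         (\<exists>U\<in>M. partial_isometry U \<and> adj U o\<^sub>L U = P \<and> U o\<^sub>L adj U = id_blinfun - P \<and>
            Q = (1 / 2) *\<^sub>R (id_blinfun + U + adj U))"
proof -
  have vN: "von_neumann_algebra M"
    using assms(3) by (simp add: finite_factor_def factor_def)
  note M = closed_op_algebra_von_neumann[OF vN]
  have M_sub: "M \<subseteq> bounded_ops"
    using vN by (simp add: von_neumann_algebra_def)
  have \<tau>: "tracial_state M \<tau>" "faithful_on M \<tau>"
    using assms(4) by (simp_all add: fn_tracial_state_def)
  have P: "P \<in> M" "is_projection P" and Q: "Q \<in> M" "is_projection Q"
    using assms(5,6) by (simp_all add: projections_of_trace_def)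
  define X where "X = (P - Q) o\<^sub>L (P - Q)"
  have X: "op_within 0 1 X"
    unfolding X_def by (rule projection_diff_square_within[OF P(2) Q(2)])
  have X_M: "X \<in> M"
    unfolding X_def by (intro closed_op_algebraD[OF M] P Q)
  note Y = op_within_complement[OF X]
  have Y_M: "id_blinfun - X \<in> M"
    by (intro closed_op_algebraD[OF M] X_M)
  have Y_eq: "((id_blinfun - P) - Q) o\<^sub>L ((id_blinfun - P) - Q) = id_blinfun - X"
    unfolding X_def by (rule projection_pair_squares[OF P(2) Q(2)])
  define s where "s = p / 2"
  have s: "0 < s" "s \<noteq> 1"
    using assms(1,2) by (simp_all add: s_def)
  define u where "u = \<tau> (cfc (\<lambda>t. t powr s) X)"
  define v where "v = \<tau> (cfc (\<lambda>t. t powr s) (id_blinfun - X))"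
  have uv: "u \<in> \<real>\<^sub>\<ge>\<^sub>0" "v \<in> \<real>\<^sub>\<ge>\<^sub>0"
    unfolding u_def v_def
    by (rule tracial_state_cfc_nonneg[OF \<tau>(1) M X_M X] tracial_state_cfc_nonneg[OF \<tau>(1) M Y_M Y];
        auto intro: continuous_on_powr_pos_exponent s)+
  have sa: "selfadjoint_op (P - Q)" "selfadjoint_op ((id_blinfun - P) - Q)"
    by (intro selfadjoint_op_intros is_projectionD P Q)+
  have norms: "p_norm \<tau> p (P - Q) = Re u powr (1 / p)"
    "p_norm \<tau> p ((id_blinfun - P) - Q) = Re v powr (1 / p)"
    using p_norm_selfadjoint[OF assms(1) sa(1) X[unfolded X_def]]
      p_norm_selfadjoint[OF assms(1) sa(2) Y[folded Y_eq]]
    by (simp_all add: u_def v_def s_def Y_eq flip: X_def)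
  have "(p_norm \<tau> p (P - Q) = p_norm \<tau> p ((id_blinfun - P) - Q) \<and>
          p_norm \<tau> p ((id_blinfun - P) - Q) = 1 / sqrt 2) \<longleftrightarrow>
      Re u = (1 / 2) powr s \<and> Re v = (1 / 2) powr s"
    unfolding norms s_def
    by (metis powr_inverse_eq_sqrt_half_iff[OF assms(1)] uv complex_nonneg_Reals_iff)
  also have "\<dots> \<longleftrightarrow> u = complex_of_real ((1 / 2) powr s) \<and> v = complex_of_real ((1 / 2) powr s)"
    using uv by (auto simp: complex_nonneg_Reals_iff complex_eq_iff)
  also have "\<dots> \<longleftrightarrow> X = (1 / 2) *\<^sub>R id_blinfun"
  proof
    assume "X = (1 / 2) *\<^sub>R id_blinfun"
    moreover from this have "id_blinfun - X = (1 / 2) *\<^sub>R id_blinfun"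
      using scaleR_left_diff_distrib[of 1 "1 / 2" "id_blinfun :: 'h \<Rightarrow>\<^sub>L 'h"] by simp
    ultimately show "u = complex_of_real ((1 / 2) powr s) \<and> v = complex_of_real ((1 / 2) powr s)"
      unfolding u_def v_def
      by (simp only: cfc_scaleR_id tracial_state_scaleR_id[OF \<tau>(1) closed_op_algebraD(2)[OF M]])
  qed (use op_eq_half_of_trace_powr[OF \<tau> M X_M X s] in \<open>simp add: u_def v_def\<close>)
  also have "\<dots> \<longleftrightarrow> (\<exists>U\<in>M. partial_isometry U \<and> adj U o\<^sub>L U = P \<and> U o\<^sub>L adj U = id_blinfun - P \<and>
            Q = (1 / 2) *\<^sub>R (id_blinfun + U + adj U))" (is "_ \<longleftrightarrow> ?R")
  proof
    assume half: "X = (1 / 2) *\<^sub>R id_blinfun"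
    have "2 *\<^sub>R (Q o\<^sub>L P) - P \<in> M"
      by (intro closed_op_algebraD[OF M] P Q)
    then show ?R
      using partial_isometry_of_projection_pair[OF P(2) Q(2) half[unfolded X_def]] by blast
  next
    assume ?R
    then show "X = (1 / 2) *\<^sub>R id_blinfun"
      using projection_diff_square_of_partial_isometry[OF P(2)] M_sub unfolding X_def by blast
  qed
  finally show ?thesis .
qed

end
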